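(* Let $f:A\to B$ be a homomorphism of Abelian groups, and let $G$ be an Abelian group which either contains an element of infinite order or is a direct sum of cyclic groups. If $f\otimes 1_G:A\otimes G\to B\otimes G$ is nontrivial, then for every $k\geq 1$ the homomorphism $f\otimes 1_{\bigotimes^k G}:A\otimes\bigotimes^kG\to B\otimes\bigotimes^kG$ is nontrivial, where $\bigotimes^kG=G\otimes\cdots\otimes G$ ($k$ factors).
   Context: All groups are Abelian; tensor products are over $\mathbb{Z}$. *)

theory Defs
  imports "HOL-Algebra.Algebra"
begin

text \<open>Abelian groups are HOL-Algebra comm_groups (written multiplicatively).
  Tensor products over Z are built concretely as quotients of free Abelian groups
  by the subgroup generated by the (multi)linearity relations.\<close>

definition tensor_rels :: "('a,'c) monoid_scheme \<Rightarrow> ('b,'d) monoid_scheme \<Rightarrow> ('a \<times> 'b \<Rightarrow>\<^sub>0 int) set" where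
  "tensor_rels A B =
     {frag_of (a \<otimes>\<^bsub>A\<^esub> a', b) - frag_of (a, b) - frag_of (a', b) | a a' b.
        a \<in> carrier A \<and> a' \<in> carrier A \<and> b \<in> carrier B}
   \<union> {frag_of (a, b \<otimes>\<^bsub>B\<^esub> b') - frag_of (a, b) - frag_of (a, b') | a b b'.
        a \<in> carrier A \<and> b \<in> carrier B \<and> b' \<in> carrier B}"

definition tensor_free :: "('a,'c) monoid_scheme \<Rightarrow> ('b,'d) monoid_scheme \<Rightarrow> ('a \<times> 'b \<Rightarrow>\<^sub>0 int) monoid" where
  "tensor_free A B = free_Abelian_group (carrier A \<times> carrier B)"

definition tensor_sub :: "('a,'c) monoid_scheme \<Rightarrow> ('b,'d) monoid_scheme \<Rightarrow> ('a \<times> 'b \<Rightarrow>\<^sub>0 int) set" where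
  "tensor_sub A B = generate (tensor_free A B) (tensor_rels A B)"

definition tensor :: "('a,'c) monoid_scheme \<Rightarrow> ('b,'d) monoid_scheme \<Rightarrow> ('a \<times> 'b \<Rightarrow>\<^sub>0 int) set monoid" where
  "tensor A B = tensor_free A B Mod tensor_sub A B"

definition tensor_map ::
  "('a,'c) monoid_scheme \<Rightarrow> ('b,'d) monoid_scheme \<Rightarrow> ('e,'g) monoid_scheme \<Rightarrow> ('f,'h) monoid_scheme \<Rightarrow>
   ('a \<Rightarrow> 'e) \<Rightarrow> ('b \<Rightarrow> 'f) \<Rightarrow> ('a \<times> 'b \<Rightarrow>\<^sub>0 int) set \<Rightarrow> ('e \<times> 'f \<Rightarrow>\<^sub>0 int) set" where
  "tensor_map A C B D f h Z =
     {y. \<exists>x\<in>Z. y \<in> Coset.r_coset (tensor_free B D) (tensor_sub B D)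
              (frag_extend (\<lambda>(a, c). frag_of (f a, h c)) x)}"

definition tpow_rels :: "nat \<Rightarrow> ('a,'c) monoid_scheme \<Rightarrow> ('a list \<Rightarrow>\<^sub>0 int) set" where
  "tpow_rels k G =
     {frag_of (xs[i := a \<otimes>\<^bsub>G\<^esub> b]) - frag_of (xs[i := a]) - frag_of (xs[i := b]) | xs i a b.
        length xs = k \<and> set xs \<subseteq> carrier G \<and> i < k \<and> a \<in> carrier G \<and> b \<in> carrier G}"

definition tpow_free :: "nat \<Rightarrow> ('a,'c) monoid_scheme \<Rightarrow> ('a list \<Rightarrow>\<^sub>0 int) monoid" where
  "tpow_free k G = free_Abelian_group {xs. length xs = k \<and> set xs \<subseteq> carrier G}"

definition tensor_power :: "nat \<Rightarrow> ('a,'c) monoid_scheme \<Rightarrow> ('a list \<Rightarrow>\<^sub>0 int) set monoid" where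
  "tensor_power k G = tpow_free k G Mod generate (tpow_free k G) (tpow_rels k G)"

definition nontrivial_map :: "('a,'c) monoid_scheme \<Rightarrow> ('b,'d) monoid_scheme \<Rightarrow> ('a \<Rightarrow> 'b) \<Rightarrow> bool" where
  "nontrivial_map A B \<phi> \<longleftrightarrow> (\<exists>x\<in>carrier A. \<phi> x \<noteq> \<one>\<^bsub>B\<^esub>)"

definition direct_sum_of_cyclic :: "('a,'c) monoid_scheme \<Rightarrow> bool" where
  "direct_sum_of_cyclic G \<longleftrightarrow>
     (\<exists>S \<subseteq> carrier G. G \<cong> sum_group S (\<lambda>s. subgroup_generated G {s}))"

end

theory Submission
  imports Defs
begin

text \<open>
  Fix \<open>b = f a\<close> and \<open>g\<close> with \<open>b \<otimes> g \<noteq> 0\<close>, and suppose that \<open>b\<close> tensored with every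
  \<open>k\<close>-fold power is \<open>0\<close>. Such a vanishing uses finitely many relations, so for each \<open>x \<in> G\<close> the
  element \<open>b \<otimes> x \<otimes> \<dots> \<otimes> x\<close> already vanishes over a finitely generated subgroup \<open>H\<close>
  containing \<open>x\<close>. Decomposing \<open>H\<close> into cyclic groups of orders \<open>n\<^sub>i\<close> (\<open>0\<close> for infinite) with
  generators \<open>s\<^sub>i\<close>, and writing \<open>x = \<Sum> e\<^sub>i s\<^sub>i\<close>, the \<open>i\<close>-th coordinate of the tensor gives
  \<open>e\<^sub>i\<^sup>k b \<in> n\<^sub>i B\<close>.

  If \<open>G\<close> has an element \<open>x\<close> of infinite order, some \<open>n\<^sub>i = 0\<close> has \<open>e\<^sub>i \<noteq> 0\<close>, so \<open>b\<close> is torsion, say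
  \<open>N b = 0\<close>. Induct on \<open>N\<close>, with \<open>x = g\<close>: if \<open>p = gcd e\<^sub>i N > 1\<close>, then \<open>(p b) \<otimes> s\<^sub>i = 0\<close> by induction,
  hence \<open>b \<otimes> e\<^sub>i s\<^sub>i = 0\<close>; if \<open>e\<^sub>i\<close> and \<open>N\<close> are coprime, then \<open>b \<in> n\<^sub>i B\<close> by Bezout, so again
  \<open>b \<otimes> s\<^sub>i = 0\<close>. Summing, \<open>b \<otimes> g = 0\<close>.

  If \<open>G\<close> is a direct sum of cyclic groups, take for \<open>x\<close> each generator \<open>s\<close> in turn, with its own
  coordinate \<open>1\<close>: then \<open>b \<in> n B\<close> for the order \<open>n\<close> of \<open>s\<close>, so \<open>b \<otimes> s = 0\<close>.
\<close>

section \<open>Cyclic coordinates on finitely generated Abelian groups\<close>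

text \<open>For a subgroup \<open>H\<close> this is a homomorphism to the integers modulo
  \<open>n\<close>, given by integer representatives. The value \<open>n = 0\<close> means a
  homomorphism to the integers themselves, so finite and infinite cyclic factors are treated
  alike.\<close>

definition additive_mod :: "('g, 'e) monoid_scheme \<Rightarrow> 'g set \<Rightarrow> int \<Rightarrow> ('g \<Rightarrow> int) \<Rightarrow> bool" where
  "additive_mod G H n c \<longleftrightarrow> (\<forall>x\<in>H. \<forall>y\<in>H. n dvd c (x \<otimes>\<^bsub>G\<^esub> y) - c x - c y)"

text \<open>Every \<open>g\<close> in \<open>H\<close> is a sum of its images under composites \<open>H \<rightarrow> \<int>/n \<rightarrow> H\<close>; this is all that is
  needed of a decomposition into cyclic groups, and it avoids choosing a basis.\<close>

definition cyclic_coords :: "('g, 'e) monoid_scheme \<Rightarrow> 'g set \<Rightarrow> bool" where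
  "cyclic_coords G H \<longleftrightarrow>
     (\<forall>g\<in>H. g \<in> generate G {s [^]\<^bsub>G\<^esub> c g | s n c.
        s \<in> H \<and> s [^]\<^bsub>G\<^esub> (n::int) = \<one>\<^bsub>G\<^esub> \<and> additive_mod G H n c})"

lemma (in group) int_pow_cong_dvd:
  fixes n a b :: int
  assumes "x \<in> carrier G" "x [^] n = \<one>" "n dvd a - b"
  shows "x [^] a = x [^] b"
  using assms by (metis dvd_trans int_pow_eq int_pow_eq_id)

context comm_group
begin

lemma cross_cancel:
  assumes "x \<in> carrier G" "u \<in> carrier G" "y \<in> carrier G" "v \<in> carrier G" "x \<otimes> u = y \<otimes> v"
  shows "x \<otimes> inv y = v \<otimes> inv u"
proof -
  have "x = y \<otimes> v \<otimes> inv u"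
    using assms by (simp add: inv_solve_right)
  then have "x = (v \<otimes> inv u) \<otimes> y"
    using assms by (simp add: m_ac)
  then show ?thesis
    using assms by (simp add: inv_solve_right')
qed

section \<open>Changing the generators of a subgroup\<close>

lemma generate_insert:
  assumes "x \<in> carrier G" "J \<subseteq> carrier G"
  shows "generate G (insert x J) = {x [^] a \<otimes> z | (a::int) z. z \<in> generate G J}"
    (is "_ = ?R")
proof
  interpret J: subgroup "generate G J" G
    by (rule generate_is_subgroup[OF assms(2)])
  have "subgroup ?R G"
  proof (rule subgroupI)
    show "?R \<subseteq> carrier G"
      using assms by auto
    show "?R \<noteq> {}"
      using J.one_closed by blast
  next
    fix u assume "u \<in> ?R"
    then obtain a :: int and z where z: "z \<in> generate G J" "u = x [^] a \<otimes> z"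
      by auto
    then have "inv u = x [^] (- a) \<otimes> inv z"
      using assms by (simp add: inv_mult int_pow_neg J.mem_carrier)
    then show "inv u \<in> ?R"
      using z J.m_inv_closed by blast
  next
    fix u v assume "u \<in> ?R" "v \<in> ?R"
    then obtain a b :: int and z w where z: "z \<in> generate G J" "u = x [^] a \<otimes> z"
      and w: "w \<in> generate G J" "v = x [^] b \<otimes> w"
      by auto
    then have "u \<otimes> v = x [^] (a + b) \<otimes> (z \<otimes> w)"
      using assms by (simp add: int_pow_mult J.mem_carrier m_ac)
    then show "u \<otimes> v \<in> ?R"
      using z w J.m_closed by blast
  qed
  moreover have "insert x J \<subseteq> ?R"
  proof
    fix u assume "u \<in> insert x J"
    then consider "u = x" | "u \<in> J" by auto
    then show "u \<in> ?R"
    proof cases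
      case 1
      then have "u = x [^] (1::int) \<otimes> \<one>" using assms by simp
      then show ?thesis using J.one_closed by blast
    next
      case 2
      then have "u = x [^] (0::int) \<otimes> u" using assms by auto
      then show ?thesis using generate.incl[OF 2] by blast
    qed
  qed
  ultimately show "generate G (insert x J) \<subseteq> ?R"
    using generate_subgroup_incl by blast
next
  interpret I: subgroup "generate G (insert x J)" G
    by (rule generate_is_subgroup) (use assms in auto)
  have "x \<in> generate G (insert x J)" by (simp add: generate.incl)
  moreover have "generate G J \<subseteq> generate G (insert x J)"
    by (rule mono_generate) auto
  ultimately show "?R \<subseteq> generate G (insert x J)"
    using subgroup_int_pow_closed[OF I.subgroup_axioms] by (auto intro!: I.m_closed)
qed

text \<open>The elementary operation of the Euclidean reduction. One inclusion suffices: the other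
  is the same statement for \<open>x \<otimes> y\<close> and \<open>inv y\<close>.\<close>

lemma generate_insert_shift:
  assumes "x \<in> carrier G" "J \<subseteq> carrier G" "y \<in> generate G J"
  shows "generate G (insert (x \<otimes> y) J) = generate G (insert x J)"
proof -
  have sub: "generate G (insert (u \<otimes> w) J) \<subseteq> generate G (insert u J)"
    if "u \<in> carrier G" "w \<in> generate G J" for u w
  proof (rule generate_subgroup_incl)
    show I: "subgroup (generate G (insert u J)) G"
      by (rule generate_is_subgroup) (use assms that in auto)
    have "w \<in> generate G (insert u J)"
      using that mono_generate[of J "insert u J"] by auto
    then show "insert (u \<otimes> w) J \<subseteq> generate G (insert u J)"
      using subgroup.m_closed[OF I] by (auto intro: generate.incl)
  qed
  have y: "y \<in> carrier G" using generate_in_carrier assms by blast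
  have "inv y \<in> generate G J"
    using assms generate_m_inv_closed by blast
  from sub[OF _ this, of "x \<otimes> y"] sub[OF assms(1,3)] show ?thesis
    using assms y by (auto simp: m_assoc)
qed

text \<open>Here \<open>y\<close> collects the quotients by \<open>d\<close> of the exponents of \<open>x\<close>, and \<open>i\<close> is a generator whose
  exponent leaves a nonzero remainder \<open>r\<close>.\<close>

lemma generate_div_mod:
  assumes "finite J" "J \<subseteq> carrier G" "x \<in> generate G J" "(d::int) > 0"
  shows "\<exists>y\<in>generate G J. x = y [^] d \<or>
           (\<exists>i\<in>J. \<exists>r w. 0 < r \<and> r < d \<and> w \<in> generate G (J - {i}) \<and> x = i [^] r \<otimes> w \<otimes> y [^] d)"
  using assms
proof (induction J arbitrary: x rule: finite_induct)
  case empty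
  then have "x = \<one>" by (simp add: generate_empty)
  then show ?case by (auto simp: generate_empty)
next
  case (insert i J)
  have i: "i \<in> carrier G" and J: "J \<subseteq> carrier G" using insert by auto
  interpret I: subgroup "generate G (insert i J)" G
    by (rule generate_is_subgroup) (use insert in auto)
  obtain a :: int and z where z: "z \<in> generate G J" "x = i [^] a \<otimes> z"
    using insert.prems generate_insert[OF i J] by auto
  have zc: "z \<in> carrier G" using z generate_in_carrier J by blast
  define q where "q = a div d"
  have iq: "i [^] q \<in> generate G (insert i J)"
    by (simp add: I.subgroup_axioms generate.incl subgroup_int_pow_closed)
  have a: "i [^] a = i [^] (a mod d) \<otimes> (i [^] q) [^] d"
    using i by (simp add: int_pow_pow int_pow_mult[symmetric] q_def)
  show ?case
  proof (cases "a mod d = 0")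
    \<comment> \<open>The new generator itself serves as the required \<open>i\<close>. All of
      \<open>z\<close> goes undivided into \<open>w\<close>, so only \<open>i [^] q\<close> enters
      the \<open>d\<close>-th power.\<close>
    case False
    then have "0 < a mod d" "a mod d < d"
      using insert.prems(3) pos_mod_bound[of d a] pos_mod_sign[of d a] by linarith+
    moreover have "x = i [^] (a mod d) \<otimes> z \<otimes> (i [^] q) [^] d"
      using z a i zc by (simp add: m_ac)
    moreover have "insert i J - {i} = J" using insert by auto
    ultimately show ?thesis using iq z by (intro bexI[OF _ iq]) auto
  next
    case True
    obtain y where y: "y \<in> generate G J" and yz: "z = y [^] d \<or>
           (\<exists>i\<in>J. \<exists>r w. 0 < r \<and> r < d \<and> w \<in> generate G (J - {i}) \<and> z = i [^] r \<otimes> w \<otimes> y [^] d)"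
      using insert.IH[OF J z(1) insert.prems(3)] by blast
    have yc: "y \<in> carrier G" using y generate_in_carrier J by blast
    have Y: "i [^] q \<otimes> y \<in> generate G (insert i J)"
      using iq y mono_generate[of J "insert i J"] by auto
    have pd: "(i [^] q \<otimes> y) [^] d = (i [^] q) [^] d \<otimes> y [^] d"
      using i yc by (simp add: int_pow_distrib)
    have x: "x = (i [^] q) [^] d \<otimes> z" using z a True i by simp
    show ?thesis
    proof (rule bexI[OF _ Y])
      from yz consider "z = y [^] d" | i' r w where "i' \<in> J" "0 < r" "r < d"
        "w \<in> generate G (J - {i'})" "z = i' [^] r \<otimes> w \<otimes> y [^] d"
        by blast
      then show "x = (i [^] q \<otimes> y) [^] d \<or>
           (\<exists>i'\<in>insert i J. \<exists>r w. 0 < r \<and> r < d \<and> w \<in> generate G (insert i J - {i'}) \<and>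
              x = i' [^] r \<otimes> w \<otimes> (i [^] q \<otimes> y) [^] d)"
      proof cases
        case 1
        then show ?thesis using x pd by simp
      next
        case 2
        have w: "w \<in> generate G (insert i J - {i'})"
          using 2(4) mono_generate[of "J - {i'}" "insert i J - {i'}"] by auto
        have wc: "w \<in> carrier G" using 2(4) J generate_in_carrier[of "J - {i'}"] by blast
        have "x = i' [^] r \<otimes> w \<otimes> (i [^] q \<otimes> y) [^] d"
          unfolding x pd 2(5) using 2(1) J i yc wc by (simp add: subsetD m_ac)
        then show ?thesis using 2 w by blast
      qed
    qed
  qed
qed

text \<open>The hypotheses make the larger span the direct product of the smaller one and the cyclic
  group of \<open>t\<close>, of order \<open>n\<close> (infinite for \<open>n = 0\<close>). Its
  coordinates are the exponent \<open>c0\<close> of \<open>t\<close> and the old coordinates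
  composed with the projection \<open>pr\<close>.\<close>

lemma cyclic_coords_direct:
  assumes J: "J \<subseteq> carrier G" and K: "cyclic_coords G (generate G J)"
    and t: "t \<in> carrier G" "t [^] (n::int) = \<one>"
    and indep: "\<And>u::int. t [^] u \<in> generate G J \<Longrightarrow> n dvd u"
  shows "cyclic_coords G (generate G (insert t J))"
proof -
  define K where "K = generate G J"
  define H where "H = generate G (insert t J)"
  interpret K: subgroup K G unfolding K_def by (rule generate_is_subgroup[OF J])
  interpret H: subgroup H G unfolding H_def by (rule generate_is_subgroup) (use J t in auto)
  have Heq: "H = {t [^] a \<otimes> z | (a::int) z. z \<in> K}"
    unfolding H_def K_def by (rule generate_insert[OF t(1) J])
  have KH: "K \<subseteq> H" unfolding H_def K_def by (rule mono_generate) auto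
  define c0 where "c0 h = (SOME a::int. \<exists>z\<in>K. h = t [^] a \<otimes> z)" for h
  define pr where "pr h = inv (t [^] c0 h) \<otimes> h" for h
  have c0: "\<exists>z\<in>K. h = t [^] c0 h \<otimes> z" if "h \<in> H" for h
    unfolding c0_def by (rule someI_ex) (use that Heq in blast)
  have pr: "pr h \<in> K" "h = t [^] c0 h \<otimes> pr h" if h: "h \<in> H" for h
  proof -
    obtain z where z: "z \<in> K" "h = t [^] c0 h \<otimes> z" using c0[OF h] by blast
    have "h \<in> carrier G" using h by (rule H.mem_carrier)
    then have "pr h = z"
      unfolding pr_def using inv_solve_left z(1,2) K.mem_carrier t(1) int_pow_closed by metis
    with z show "pr h \<in> K" "h = t [^] c0 h \<otimes> pr h" by auto
  qed
  have add: "additive_mod G H n c0"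
    unfolding additive_mod_def
  proof (intro ballI)
    fix x y assume xy: "x \<in> H" "y \<in> H"
    then have xyH: "x \<otimes> y \<in> H" by simp
    have k: "pr x \<in> carrier G" "pr y \<in> carrier G" "pr (x \<otimes> y) \<in> carrier G"
      using pr(1) xy xyH K.mem_carrier by auto
    have "t [^] c0 (x \<otimes> y) \<otimes> pr (x \<otimes> y) = (t [^] c0 x \<otimes> pr x) \<otimes> (t [^] c0 y \<otimes> pr y)"
      by (simp only: pr(2)[OF xyH, symmetric] pr(2)[OF xy(1), symmetric] pr(2)[OF xy(2), symmetric])
    also have "\<dots> = t [^] (c0 x + c0 y) \<otimes> (pr x \<otimes> pr y)"
      using t k by (simp add: int_pow_mult m_ac)
    finally have eq: "t [^] c0 (x \<otimes> y) \<otimes> pr (x \<otimes> y) = t [^] (c0 x + c0 y) \<otimes> (pr x \<otimes> pr y)" .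
    \<comment> \<open>The additivity defect of \<open>c0\<close> is an exponent that carries
      \<open>t\<close> into \<open>K\<close>, so \<open>indep\<close> makes it a multiple of
      \<open>n\<close>.\<close>
    have "t [^] (c0 (x \<otimes> y) - (c0 x + c0 y)) = t [^] c0 (x \<otimes> y) \<otimes> inv (t [^] (c0 x + c0 y))"
      using t by (simp add: int_pow_diff)
    also have "\<dots> = pr x \<otimes> pr y \<otimes> inv (pr (x \<otimes> y))"
      by (rule cross_cancel[OF _ _ _ _ eq]) (use k t in auto)
    also have "\<dots> \<in> K" using pr(1) xy xyH by auto
    finally have "n dvd c0 (x \<otimes> y) - (c0 x + c0 y)" using indep unfolding K_def by blast
    then show "n dvd c0 (x \<otimes> y) - c0 x - c0 y" by (simp add: algebra_simps)
  qed
  \<comment> \<open>Although \<open>c0\<close> is additive only modulo \<open>n\<close>, the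
    relation \<open>t [^] n = \<one>\<close> makes \<open>t [^] c0\<close> multiplicative, so
    \<open>pr\<close> is a genuine homomorphism on \<open>H\<close>.\<close>
  have pr_mult: "pr (x \<otimes> y) = pr x \<otimes> pr y" if xy: "x \<in> H" "y \<in> H" for x y
  proof -
    have "n dvd c0 (x \<otimes> y) - (c0 x + c0 y)"
      using add xy unfolding additive_mod_def by (simp add: algebra_simps)
    then have "t [^] c0 (x \<otimes> y) = t [^] c0 x \<otimes> t [^] c0 y"
      using int_pow_cong_dvd[OF t] t(1) by (metis int_pow_mult)
    then show ?thesis
      unfolding pr_def using t xy by (simp add: inv_mult m_ac H.mem_carrier)
  qed
  show ?thesis
    unfolding cyclic_coords_def H_def[symmetric]
  proof
    fix g assume g: "g \<in> H"
    let ?X = "{s [^] c g | s n c. s \<in> H \<and> s [^] (n::int) = \<one> \<and> additive_mod G H n c}"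
    have XG: "?X \<subseteq> carrier G" using H.mem_carrier by auto
    interpret X: subgroup "generate G ?X" G by (rule generate_is_subgroup[OF XG])
    have "t \<in> H" unfolding H_def by (simp add: generate.incl)
    then have 1: "t [^] c0 g \<in> generate G ?X"
      using t add by (intro generate.incl) blast
    have "pr g \<in> generate G {s [^] c (pr g) | s n c. s \<in> K \<and> s [^] (n::int) = \<one> \<and> additive_mod G K n c}"
      using K pr(1)[OF g] unfolding cyclic_coords_def K_def by blast
    also have "\<dots> \<subseteq> generate G ?X"
    proof (rule mono_generate, rule subsetI)
      fix v assume "v \<in> {s [^] c (pr g) | s n c. s \<in> K \<and> s [^] (n::int) = \<one> \<and> additive_mod G K n c}"
      then obtain s c and m :: int where s: "s \<in> K" "s [^] m = \<one>" "additive_mod G K m c" "v = s [^] c (pr g)"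
        by blast
      have "additive_mod G H m (c \<circ> pr)"
        using s(3) pr(1) pr_mult unfolding additive_mod_def by simp
      moreover have "v = s [^] (c \<circ> pr) g" using s by simp
      ultimately show "v \<in> ?X" using s KH by blast
    qed
    finally have 2: "pr g \<in> generate G ?X" .
    show "g \<in> generate G ?X"
      using X.m_closed[OF 1 2] pr(2)[OF g] by simp
  qed
qed

text \<open>Euclid's algorithm: the least positive exponent \<open>d\<close> for which some generator \<open>t\<close> of some
  generating set with \<open>Suc r\<close> elements has \<open>t [^] d\<close> in the span of the others splits off a cyclic
  direct factor of order \<open>d\<close>.\<close>

lemma cyclic_coords_euclid:
  assumes step: "\<And>J. finite J \<Longrightarrow> card J \<le> r \<Longrightarrow> J \<subseteq> carrier G \<Longrightarrow> cyclic_coords G (generate G J)"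
    and "finite J" "card J \<le> r" "J \<subseteq> carrier G" "t \<in> carrier G"
    and "d > 0" "t [^] int d \<in> generate G J"
  shows "cyclic_coords G (generate G (insert t J))"
  using assms(2-)
proof (induction d arbitrary: t J rule: less_induct)
  case (less d t J)
  note J = \<open>J \<subseteq> carrier G\<close> and t = \<open>t \<in> carrier G\<close>
  have d: "int d > 0" using less.prems by simp
  obtain y where y: "y \<in> generate G J" and alt: "t [^] int d = y [^] int d \<or>
           (\<exists>i\<in>J. \<exists>e w. 0 < e \<and> e < int d \<and> w \<in> generate G (J - {i}) \<and>
              t [^] int d = i [^] e \<otimes> w \<otimes> y [^] int d)"
    using generate_div_mod[OF less.prems(1) J less.prems(6) d] by blast
  have yc: "y \<in> carrier G" using y generate_in_carrier J by blast
  \<comment> \<open>The shift keeps the span and cancels a \<open>d\<close>-th power: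
    \<open>t' [^] int d\<close> becomes \<open>\<one>\<close> in case 1 and
    \<open>i [^] e \<otimes> w\<close> in case 2.\<close>
  define t' where "t' = t \<otimes> inv y"
  have t': "t' \<in> carrier G" unfolding t'_def using t yc by simp
  have gen: "generate G (insert t' J) = generate G (insert t J)"
    unfolding t'_def using generate_insert_shift[OF t J] generate_m_inv_closed[OF J y] by blast
  have td: "t' [^] int d = t [^] int d \<otimes> inv (y [^] int d)"
    unfolding t'_def using t yc by (simp add: int_pow_distrib int_pow_inv)
  from alt consider "t [^] int d = y [^] int d" | i e w where "i \<in> J" "0 < e" "e < int d"
     "w \<in> generate G (J - {i})" "t [^] int d = i [^] e \<otimes> w \<otimes> y [^] int d"
    by blast
  then show ?case
  proof cases
    case 1
    then have t'd: "t' [^] int d = \<one>" using td yc by simp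
    show ?thesis
    proof (cases "\<forall>u::int. t' [^] u \<in> generate G J \<longrightarrow> int d dvd u")
      case True
      then show ?thesis
        using cyclic_coords_direct[OF J step[OF less.prems(1,2) J] t' t'd] gen by simp
    next
      case False
      then obtain u :: int where u: "t' [^] u \<in> generate G J" "\<not> int d dvd u" by blast
      \<comment> \<open>Since \<open>t' [^] int d = \<one>\<close>, the exponent \<open>u\<close>
        can be reduced modulo \<open>d\<close>. This gives a smaller positive exponent for
        \<open>t'\<close> over the same \<open>J\<close>.\<close>
      define v where "v = nat (u mod int d)"
      have v: "0 < v" "v < d" "int v = u mod int d"
        using u(2) d pos_mod_bound[OF d, of u] pos_mod_sign[OF d, of u] unfolding v_def dvd_eq_mod_eq_0
        by linarith+
      have "t' [^] int v = t' [^] u"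
        by (rule int_pow_cong_dvd[OF t' t'd]) (simp add: v mod_eq_dvd_iff[symmetric])
      then have "cyclic_coords G (generate G (insert t' J))"
        using less.IH[OF v(2) less.prems(1,2) J t' v(1)] u by simp
      then show ?thesis using gen by simp
    qed
  next
    case 2
    have i: "i \<in> carrier G" using 2 J by blast
    have wc: "w \<in> carrier G" using 2(4) J generate_in_carrier[of "J - {i}"] by blast
    \<comment> \<open>Exchange step: \<open>i\<close> takes the role of \<open>t\<close>, and
      \<open>t'\<close> takes the place of \<open>i\<close> among the other generators. The power
      \<open>i [^] e\<close> with \<open>e < d\<close> lies in the span of
      \<open>J'\<close>.\<close>
    define J' where "J' = insert t' (J - {i})"
    have J': "finite J'" "J' \<subseteq> carrier G" "insert i J' = insert t' J"
      using less.prems J t' 2 unfolding J'_def by auto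
    have "card J' \<le> card J"
      unfolding J'_def using less.prems(1) 2(1)
      by (metis card.insert_remove card_Suc_Diff1 card_insert_le_m1 card_gt_0_iff diff_Suc_1 empty_iff le_refl)
    then have card: "card J' \<le> r" using less.prems(2) by simp
    interpret J': subgroup "generate G J'" G by (rule generate_is_subgroup[OF J'(2)])
    have "w \<in> generate G J'"
      using 2(4) mono_generate[of "J - {i}" J'] unfolding J'_def by auto
    moreover have "t' [^] int d \<in> generate G J'"
      by (rule subgroup_int_pow_closed[OF J'.subgroup_axioms])
         (simp add: J'_def generate.incl)
    moreover have "i [^] e = t' [^] int d \<otimes> inv w"
      unfolding td 2(5) using i wc yc by (simp add: m_ac) (simp add: m_assoc[symmetric])
    ultimately have "i [^] int (nat e) \<in> generate G J'"
      using 2 by simp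
    then have "cyclic_coords G (generate G (insert i J'))"
      using less.IH[of "nat e" J' i] 2 J' card i by simp
    then show ?thesis using J' gen by simp
  qed
qed

text \<open>The induction runs over a bound on the number of generators, because the Euclidean step
  moves between different generating sets of bounded size.\<close>

lemma cyclic_coords_generate:
  assumes "finite J" "J \<subseteq> carrier G"
  shows "cyclic_coords G (generate G J)"
proof -
  have "\<forall>J. finite J \<and> card J \<le> r \<and> J \<subseteq> carrier G \<longrightarrow> cyclic_coords G (generate G J)" for r
  proof (induction r)
    case 0
    then show ?case
      by (auto simp: generate_empty cyclic_coords_def intro: generate.one)
  next
    case (Suc r)
    show ?case
    proof (intro allI impI)
      fix J assume J: "finite J \<and> card J \<le> Suc r \<and> J \<subseteq> carrier G"
      show "cyclic_coords G (generate G J)"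
      proof (cases "J = {}")
        case True
        then show ?thesis using Suc.IH by simp
      next
        case False
        then obtain t K where K: "J = insert t K" "t \<notin> K" by (meson Set.set_insert ex_in_conv)
        then have K': "finite K" "card K \<le> r" "K \<subseteq> carrier G" "t \<in> carrier G" using J by auto
        have coords: "cyclic_coords G (generate G K)" using Suc.IH K' by blast
        interpret K: subgroup "generate G K" G by (rule generate_is_subgroup[OF K'(3)])
        show ?thesis
        proof (cases "\<exists>u::int. u \<noteq> 0 \<and> t [^] u \<in> generate G K")
          case True
          then obtain u :: int where u: "u \<noteq> 0" "t [^] u \<in> generate G K" by blast
          have "t [^] (- u) \<in> generate G K"
            using K.m_inv_closed[OF u(2)] K'(4) by (simp add: int_pow_neg)
          then have "t [^] int (nat \<bar>u\<bar>) \<in> generate G K"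
            using u(2) by (cases "u > 0") auto
          then show ?thesis
            using cyclic_coords_euclid[of r K t "nat \<bar>u\<bar>"] Suc.IH K K' u(1) by auto
        next
          \<comment> \<open>No power of \<open>t\<close> with nonzero exponent lies in the span of
            \<open>K\<close>, so \<open>t\<close> splits off an infinite cyclic factor, with modulus
            0.\<close>
          case False
          then have "\<And>u::int. t [^] u \<in> generate G K \<Longrightarrow> 0 dvd u" by auto
          then show ?thesis
            using cyclic_coords_direct[OF K'(3) coords K'(4), of 0] K by simp
        qed
      qed
    qed
  qed
  then show ?thesis using assms by blast
qed

end

section \<open>Vanishing in tensor powers\<close>

lemma additive_mod_mono: "additive_mod G H n c \<Longrightarrow> K \<subseteq> H \<Longrightarrow> additive_mod G K n c"
  unfolding additive_mod_def by blast

text \<open>The linear extension of \<open>xs\<close> to the product of its coordinates. It passes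
  through the free Abelian group on the one-point type, whose coefficient at \<open>()\<close> is
  the integer wanted.\<close>

definition prod_eval :: "('g \<Rightarrow> int) \<Rightarrow> ('g list \<Rightarrow>\<^sub>0 int) \<Rightarrow> int" where
  "prod_eval c z =
     Poly_Mapping.lookup (frag_extend (\<lambda>xs. frag_cmul (prod_list (map c xs)) (frag_of ())) z) ()"

lemma prod_eval_simps [simp]:
  "prod_eval c 0 = 0"
  "prod_eval c (frag_of xs) = prod_list (map c xs)"
  "prod_eval c (x + y) = prod_eval c x + prod_eval c y"
  "prod_eval c (x - y) = prod_eval c x - prod_eval c y"
  "prod_eval c (- x) = - prod_eval c x"
  by (simp_all add: prod_eval_def frag_extend_add frag_extend_diff frag_extend_minus
      lookup_add lookup_minus)

lemma prod_list_map_update: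
  fixes c :: "'g \<Rightarrow> int"
  assumes "i < length xs"
  shows "prod_list (map c (xs[i := a])) =
    c a * (prod_list (map c (take i xs)) * prod_list (map c (drop (Suc i) xs)))"
  using assms by (simp add: upd_conv_take_nth_drop)

lemma tpow_rels_subset:
  assumes "comm_group G"
  shows "tpow_rels k G \<subseteq> carrier (tpow_free k G)"
proof
  interpret comm_group G by fact
  fix z assume "z \<in> tpow_rels k G"
  then obtain xs i a b where z: "z = frag_of (xs[i := a \<otimes>\<^bsub>G\<^esub> b]) - frag_of (xs[i := a]) - frag_of (xs[i := b])"
    and x: "length xs = k" "set xs \<subseteq> carrier G" "i < k" "a \<in> carrier G" "b \<in> carrier G"
    unfolding tpow_rels_def by blast
  have "set (xs[i := y]) \<subseteq> carrier G" if "y \<in> carrier G" for y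
    using set_update_subset_insert[of xs i y] x that by blast
  then have *: "xs[i := y] \<in> {xs. length xs = k \<and> set xs \<subseteq> carrier G}" if "y \<in> carrier G" for y
    using x that by simp
  have "Poly_Mapping.keys z \<subseteq> {xs[i := a \<otimes>\<^bsub>G\<^esub> b], xs[i := a], xs[i := b]}"
    unfolding z using keys_diff[of "frag_of (xs[i := a \<otimes>\<^bsub>G\<^esub> b]) - frag_of (xs[i := a])" "frag_of (xs[i := b])"]
      keys_diff[of "frag_of (xs[i := a \<otimes>\<^bsub>G\<^esub> b])" "frag_of (xs[i := a])"] by auto
  then show "z \<in> carrier (tpow_free k G)"
    unfolding tpow_free_def using *[OF m_closed[OF x(4,5)]] *[OF x(4)] *[OF x(5)] by auto
qed

lemma comm_group_tpow_free: "comm_group (tpow_free k G)"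
  unfolding tpow_free_def by (rule abelian_free_Abelian_group)

lemma comm_group_tensor_free: "comm_group (tensor_free A B)"
  unfolding tensor_free_def by (rule abelian_free_Abelian_group)

text \<open>A single relation needs additivity of \<open>c\<close> only at the two summands
  \<open>a\<close> and \<open>b\<close>, since the other slots contribute a common factor. Only
  finitely many relations enter \<open>z\<close>, so one finite \<open>S\<close>, chosen before
  \<open>c\<close> and \<open>n\<close>, works for all of them.\<close>

lemma tpow_relation_finitely_supported:
  assumes G: "comm_group G" and "z \<in> generate (tpow_free k G) (tpow_rels k G)"
  shows "\<exists>S. finite S \<and> S \<subseteq> carrier G \<and>
    (\<forall>c n. additive_mod G (generate G S) n c \<longrightarrow> n dvd prod_eval c z)"
proof -
  interpret comm_group G by fact
  have rel: "\<exists>S. finite S \<and> S \<subseteq> carrier G \<and>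
    (\<forall>c n. additive_mod G (generate G S) n c \<longrightarrow> n dvd prod_eval c h)"
    if rel: "h \<in> tpow_rels k G" for h
  proof -
    obtain xs i a b where h: "h = frag_of (xs[i := a \<otimes>\<^bsub>G\<^esub> b]) - frag_of (xs[i := a]) - frag_of (xs[i := b])"
      and x: "length xs = k" "i < k" "a \<in> carrier G" "b \<in> carrier G"
      using rel unfolding tpow_rels_def by blast
    have "n dvd prod_eval c h" if "additive_mod G (generate G {a, b}) n c" for c n
    proof -
      have "n dvd c (a \<otimes>\<^bsub>G\<^esub> b) - c a - c b"
        using that unfolding additive_mod_def by (simp add: generate.incl)
      then show ?thesis
        using x unfolding h by (simp add: prod_list_map_update left_diff_distrib[symmetric])
    qed
    then show ?thesis using x by (intro exI[of _ "{a, b}"]) auto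
  qed
  show ?thesis
    using assms(2)
  proof (induction rule: generate.induct)
    case one
    then show ?case by (intro exI[of _ "{}"]) (simp add: tpow_free_def)
  next
    case (incl h)
    then show ?case by (rule rel)
  next
    case (inv h)
    then have "inv\<^bsub>tpow_free k G\<^esub> h = - h"
      using tpow_rels_subset[OF G, of k] unfolding tpow_free_def by auto
    then show ?case using rel[OF inv] by simp
  next
    case (eng h1 h2)
    then obtain S1 S2 where S1: "finite S1" "S1 \<subseteq> carrier G"
        "\<And>c n. additive_mod G (generate G S1) n c \<Longrightarrow> n dvd prod_eval c h1"
      and S2: "finite S2" "S2 \<subseteq> carrier G"
        "\<And>c n. additive_mod G (generate G S2) n c \<Longrightarrow> n dvd prod_eval c h2"
      by metis
    have "n dvd prod_eval c (h1 \<otimes>\<^bsub>tpow_free k G\<^esub> h2)" if "additive_mod G (generate G (S1 \<union> S2)) n c" for c n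
    proof -
      have "n dvd prod_eval c h1" "n dvd prod_eval c h2"
        by (rule S1(3) S2(3), rule additive_mod_mono[OF that], rule mono_generate, simp)+
      then show ?thesis by (simp add: tpow_free_def)
    qed
    then show ?case using S1 S2 by (intro exI[of _ "S1 \<union> S2"]) auto
  qed
qed

text \<open>A map \<open>c\<close> that is additive on a subgroup only does not induce a map on the tensor power of \<open>G\<close>,
  so cosets are evaluated at a representative that is chosen independently of \<open>c\<close>.\<close>

definition tpow_rep :: "('g list \<Rightarrow>\<^sub>0 int) set \<Rightarrow> ('g list \<Rightarrow>\<^sub>0 int)" where
  "tpow_rep t = (SOME z. z \<in> t)"

lemma tpow_rep_coset:
  assumes G: "comm_group G" and z: "z \<in> carrier (tpow_free k G)"
  defines "N \<equiv> generate (tpow_free k G) (tpow_rels k G)"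
  shows "tpow_rep (N #>\<^bsub>tpow_free k G\<^esub> z) - z \<in> N"
proof -
  interpret F: comm_group "tpow_free k G" by (rule comm_group_tpow_free)
  have N: "subgroup N (tpow_free k G)"
    unfolding N_def by (rule F.generate_is_subgroup[OF tpow_rels_subset[OF G]])
  have "tpow_rep (N #>\<^bsub>tpow_free k G\<^esub> z) \<in> N #>\<^bsub>tpow_free k G\<^esub> z"
    unfolding tpow_rep_def by (rule someI, rule F.rcos_self[OF z N])
  then show ?thesis by (auto simp: r_coset_def tpow_free_def)
qed

text \<open>Chosen representatives are not additive, but the defect lies in the subgroup of
  relations, where the finite support lemma applies.\<close>

lemma tpow_rep_mult:
  assumes G: "comm_group G" and t: "t \<in> carrier (tensor_power k G)" "t' \<in> carrier (tensor_power k G)"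
  shows "tpow_rep (t \<otimes>\<^bsub>tensor_power k G\<^esub> t') - tpow_rep t - tpow_rep t'
           \<in> generate (tpow_free k G) (tpow_rels k G)" (is "_ \<in> ?N")
proof -
  interpret F: comm_group "tpow_free k G" by (rule comm_group_tpow_free)
  interpret N: subgroup ?N "tpow_free k G"
    by (rule F.generate_is_subgroup[OF tpow_rels_subset[OF G]])
  interpret N: normal ?N "tpow_free k G"
    by (rule F.subgroup_imp_normal[OF N.subgroup_axioms])
  obtain x y where x: "x \<in> carrier (tpow_free k G)" "t = ?N #>\<^bsub>tpow_free k G\<^esub> x"
    and y: "y \<in> carrier (tpow_free k G)" "t' = ?N #>\<^bsub>tpow_free k G\<^esub> y"
    using t unfolding tensor_power_def carrier_FactGroup by blast
  have xy: "t \<otimes>\<^bsub>tensor_power k G\<^esub> t' = ?N #>\<^bsub>tpow_free k G\<^esub> (x + y)"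
    unfolding tensor_power_def x y using N.rcos_sum[OF x(1) y(1)] by (simp add: tpow_free_def)
  have "x + y \<in> carrier (tpow_free k G)"
    using F.m_closed[OF x(1) y(1)] by (simp add: tpow_free_def)
  then have 1: "tpow_rep (t \<otimes>\<^bsub>tensor_power k G\<^esub> t') - (x + y) \<in> ?N"
    unfolding xy by (rule tpow_rep_coset[OF G])
  have 2: "tpow_rep t - x \<in> ?N" "tpow_rep t' - y \<in> ?N"
    unfolding x y by (rule tpow_rep_coset[OF G x(1)], rule tpow_rep_coset[OF G y(1)])
  have inv: "- u \<in> ?N" if "u \<in> ?N" for u
    using N.m_inv_closed[OF that] N.mem_carrier[OF that] by (simp add: tpow_free_def)
  have add: "u + v \<in> ?N" if "u \<in> ?N" "v \<in> ?N" for u v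
    using N.m_closed[OF that] by (simp add: tpow_free_def)
  from add[OF add[OF 1 inv[OF 2(1)]] inv[OF 2(2)]] show ?thesis by (simp add: algebra_simps)
qed

text \<open>The subgroup \<open>n B\<close> in multiplicative notation; it is trivial for
  \<open>n = 0\<close>.\<close>

definition int_powers :: "('b, 'd) monoid_scheme \<Rightarrow> int \<Rightarrow> 'b set" where
  "int_powers B n = {y [^]\<^bsub>B\<^esub> n | y. y \<in> carrier B}"

lemma (in comm_group) subgroup_int_powers: "subgroup (int_powers G n) G"
proof (rule subgroupI)
  show "int_powers G n \<noteq> {}" unfolding int_powers_def by blast
next
  fix a assume "a \<in> int_powers G n"
  then obtain y where "y \<in> carrier G" "a = y [^] n" unfolding int_powers_def by blast
  then have "inv a = (inv y) [^] n" "inv y \<in> carrier G" by (auto simp: int_pow_inv)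
  then show "inv a \<in> int_powers G n" unfolding int_powers_def by blast
next
  fix a b assume "a \<in> int_powers G n" "b \<in> int_powers G n"
  then obtain y z where "y \<in> carrier G" "a = y [^] n" "z \<in> carrier G" "b = z [^] n"
    unfolding int_powers_def by blast
  then have "a \<otimes> b = (y \<otimes> z) [^] n" "y \<otimes> z \<in> carrier G" by (auto simp: int_pow_distrib)
  then show "a \<otimes> b \<in> int_powers G n" unfolding int_powers_def by blast
qed (auto simp: int_powers_def)

lemma (in comm_group) int_pow_in_int_powers:
  assumes "x \<in> carrier G" "n dvd a"
  shows "x [^] a \<in> int_powers G n"
proof -
  obtain q where "a = q * n" using assms(2) by (auto simp: dvd_def mult.commute)
  then have "x [^] a = (x [^] q) [^] n" using assms by (simp add: int_pow_pow)
  then show ?thesis unfolding int_powers_def using assms by blast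
qed

section \<open>Relations in the tensor product with a tensor power\<close>

lemma tensor_rels_subset:
  fixes A :: "('a, 'c) monoid_scheme" and B :: "('b, 'd) monoid_scheme"
  assumes "group A" "group B"
  shows "tensor_rels A B \<subseteq> carrier (tensor_free A B)"
proof -
  interpret A: group A by fact
  interpret B: group B by fact
  have keys: "Poly_Mapping.keys (frag_of u - frag_of v - frag_of w) \<subseteq> {u, v, w}" for u v w :: "'a \<times> 'b"
    using keys_diff[of "frag_of u - frag_of v" "frag_of w"] keys_diff[of "frag_of u" "frag_of v"] by auto
  show ?thesis
    unfolding tensor_rels_def tensor_free_def
    by (auto dest!: subsetD[OF keys])
qed

lemma comm_group_tensor_power:
  assumes G: "comm_group G"
  shows "comm_group (tensor_power k G)"
  unfolding tensor_power_def
  by (rule comm_group.abelian_FactGroup[OF comm_group_tpow_free],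
      rule group.generate_is_subgroup[OF comm_group.axioms(2)[OF comm_group_tpow_free] tpow_rels_subset[OF G]])

lemma hom_free_diff:
  assumes "comm_group B" "h \<in> hom (free_Abelian_group S) B"
    "Poly_Mapping.keys x \<subseteq> S" "Poly_Mapping.keys y \<subseteq> S"
  shows "h (x - y) = h x \<otimes>\<^bsub>B\<^esub> inv\<^bsub>B\<^esub> (h y)"
proof -
  interpret B: comm_group B by fact
  interpret h: group_hom "free_Abelian_group S" B h
    by (intro group_hom.intro group_hom_axioms.intro) (simp_all add: assms(2) B.is_group)
  have "h (x - y) = h (x \<otimes>\<^bsub>free_Abelian_group S\<^esub> inv\<^bsub>free_Abelian_group S\<^esub> y)"
    using assms by simp
  also have "\<dots> = h x \<otimes>\<^bsub>B\<^esub> inv\<^bsub>B\<^esub> (h y)"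
    using h.hom_mult[of x "inv\<^bsub>free_Abelian_group S\<^esub> y"] h.hom_inv[of y] assms(3,4) by simp
  finally show ?thesis .
qed

text \<open>The map \<open>h\<close> sends \<open>b \<otimes> t\<close> to \<open>b\<close> raised
  to the evaluation of \<open>t\<close>. It lives on the free group and need not respect the
  relations, but on the finitely many that produce \<open>z\<close> it is trivial modulo
  \<open>n B\<close> as soon as \<open>c\<close> is additive on a suitable finitely generated
  subgroup.\<close>

lemma tensor_tpow_relation_finitely_supported:
  assumes G: "comm_group G" and B: "comm_group B"
    and z: "z \<in> tensor_sub B (tensor_power k G)"
  shows "\<exists>S. finite S \<and> S \<subseteq> carrier G \<and>
    (\<forall>c n h. additive_mod G (generate G S) n c \<and> h \<in> hom (tensor_free B (tensor_power k G)) B \<and>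
       (\<forall>b\<in>carrier B. \<forall>t\<in>carrier (tensor_power k G).
          h (frag_of (b, t)) = b [^]\<^bsub>B\<^esub> prod_eval c (tpow_rep t)) \<longrightarrow> h z \<in> int_powers B n)"
    (is "\<exists>S. ?P S z")
proof -
  interpret G: comm_group G by fact
  interpret B: comm_group B by fact
  let ?T = "tensor_power k G"
  interpret T: comm_group ?T by (rule comm_group_tensor_power[OF G])
  let ?F = "tensor_free B ?T"
  interpret F: comm_group ?F by (rule comm_group_tensor_free)
  have pw: "subgroup (int_powers B n) B" for n by (rule B.subgroup_int_powers)
  have hdiff: "h (frag_of u - frag_of v - frag_of w)
        = h (frag_of u) \<otimes>\<^bsub>B\<^esub> inv\<^bsub>B\<^esub> h (frag_of v) \<otimes>\<^bsub>B\<^esub> inv\<^bsub>B\<^esub> h (frag_of w)"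
    if "h \<in> hom ?F B" "{u, v, w} \<subseteq> carrier B \<times> carrier ?T" for h u v w
  proof -
    have "Poly_Mapping.keys (frag_of u - frag_of v) \<subseteq> carrier B \<times> carrier ?T"
      using keys_diff[of "frag_of u" "frag_of v"] that(2) by auto
    then show ?thesis
      using that by (simp add: hom_free_diff[OF B, of h "carrier B \<times> carrier ?T"] tensor_free_def)
  qed
  have rel: "\<exists>S. ?P S r" if r: "r \<in> tensor_rels B ?T" for r
    using r unfolding tensor_rels_def
  proof (elim UnE CollectE exE conjE)
    \<comment> \<open>Linearity in \<open>B\<close> is respected exactly, because raising to a fixed
      exponent is a homomorphism; the empty support suffices.\<close>
    fix a a' t
    assume r: "r = frag_of (a \<otimes>\<^bsub>B\<^esub> a', t) - frag_of (a, t) - frag_of (a', t)"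
      and a: "a \<in> carrier B" "a' \<in> carrier B" "t \<in> carrier ?T"
    have "h r = \<one>\<^bsub>B\<^esub>"
      if h: "h \<in> hom ?F B" and e: "\<forall>b\<in>carrier B. \<forall>t\<in>carrier ?T. h (frag_of (b, t)) = b [^]\<^bsub>B\<^esub> prod_eval c (tpow_rep t)"
      for c h
    proof -
      have "h r = (a \<otimes>\<^bsub>B\<^esub> a') [^]\<^bsub>B\<^esub> prod_eval c (tpow_rep t)
          \<otimes>\<^bsub>B\<^esub> inv\<^bsub>B\<^esub> (a [^]\<^bsub>B\<^esub> prod_eval c (tpow_rep t)) \<otimes>\<^bsub>B\<^esub> inv\<^bsub>B\<^esub> (a' [^]\<^bsub>B\<^esub> prod_eval c (tpow_rep t))"
        unfolding r using hdiff[OF h] a e by simp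
      also have "\<dots> = \<one>\<^bsub>B\<^esub>"
        using a by (simp add: B.int_pow_distrib B.m_ac)
      finally show ?thesis .
    qed
    then have "h r \<in> int_powers B n"
      if "h \<in> hom ?F B" "\<forall>b\<in>carrier B. \<forall>t\<in>carrier ?T. h (frag_of (b, t)) = b [^]\<^bsub>B\<^esub> prod_eval c (tpow_rep t)"
      for c n h
      using that subgroup.one_closed[OF pw] by metis
    then show ?thesis by (intro exI[of _ "{}"] conjI finite.emptyI empty_subsetI) blast
  next
    \<comment> \<open>Linearity in the tensor power fails by the evaluated defect of
      \<open>tpow_rep\<close>, which is a multiple of \<open>n\<close> once \<open>c\<close> is
      additive on the support of that defect.\<close>
    fix b t t'
    assume r: "r = frag_of (b, t \<otimes>\<^bsub>?T\<^esub> t') - frag_of (b, t) - frag_of (b, t')"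
      and a: "b \<in> carrier B" "t \<in> carrier ?T" "t' \<in> carrier ?T"
    obtain S where S: "finite S" "S \<subseteq> carrier G"
        "\<And>c n. additive_mod G (generate G S) n c \<Longrightarrow>
           n dvd prod_eval c (tpow_rep (t \<otimes>\<^bsub>?T\<^esub> t') - tpow_rep t - tpow_rep t')"
      using tpow_relation_finitely_supported[OF G tpow_rep_mult[OF G a(2,3)]] by blast
    have "h r \<in> int_powers B n"
      if "additive_mod G (generate G S) n c"
        and h: "h \<in> hom ?F B" and e: "\<forall>b\<in>carrier B. \<forall>t\<in>carrier ?T. h (frag_of (b, t)) = b [^]\<^bsub>B\<^esub> prod_eval c (tpow_rep t)"
      for c n h
    proof -
      have "h r = b [^]\<^bsub>B\<^esub> prod_eval c (tpow_rep (t \<otimes>\<^bsub>?T\<^esub> t'))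
          \<otimes>\<^bsub>B\<^esub> inv\<^bsub>B\<^esub> (b [^]\<^bsub>B\<^esub> prod_eval c (tpow_rep t)) \<otimes>\<^bsub>B\<^esub> inv\<^bsub>B\<^esub> (b [^]\<^bsub>B\<^esub> prod_eval c (tpow_rep t'))"
        unfolding r using hdiff[OF h] a e T.m_closed[OF a(2,3)] by simp
      also have "\<dots> = b [^]\<^bsub>B\<^esub> prod_eval c (tpow_rep (t \<otimes>\<^bsub>?T\<^esub> t') - tpow_rep t - tpow_rep t')"
        using a by (simp add: B.int_pow_diff)
      finally show ?thesis
        using B.int_pow_in_int_powers[OF a(1) S(3)[OF that(1)]] by simp
    qed
    then show ?thesis using S by (intro exI[of _ S]) blast
  qed
  have carr: "tensor_rels B ?T \<subseteq> carrier ?F"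
    by (rule tensor_rels_subset) (rule B.is_group T.is_group)+
  have gencarr: "u \<in> carrier ?F" if "u \<in> generate ?F (tensor_rels B ?T)" for u
    using F.generate_in_carrier[OF carr that] .
  have gh: "group_hom ?F B h" if "h \<in> hom ?F B" for h
    by (intro group_hom.intro group_hom_axioms.intro that F.is_group B.is_group)
  show ?thesis
    using z unfolding tensor_sub_def
  proof (induction rule: generate.induct)
    case one
    then show ?case
      using subgroup.one_closed[OF pw] group_hom.hom_one[OF gh] by (intro exI[of _ "{}"]) auto
  next
    case (incl r)
    then show ?case by (rule rel)
  next
    case (inv r)
    from rel[OF inv] obtain S where S: "?P S r" ..
    have hinv: "h (inv\<^bsub>?F\<^esub> r) = inv\<^bsub>B\<^esub> (h r)" if "h \<in> hom ?F B" for h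
      using group_hom.hom_inv[OF gh[OF that]] subsetD[OF carr inv] by simp
    have "?P S (inv\<^bsub>?F\<^esub> r)"
    proof (intro conjI allI impI)
      fix c n h
      assume h: "additive_mod G (generate G S) n c \<and> h \<in> hom ?F B \<and>
       (\<forall>b\<in>carrier B. \<forall>t\<in>carrier ?T. h (frag_of (b, t)) = b [^]\<^bsub>B\<^esub> prod_eval c (tpow_rep t))"
      then have "h (inv\<^bsub>?F\<^esub> r) = inv\<^bsub>B\<^esub> h r" by (intro hinv) simp
      then show "h (inv\<^bsub>?F\<^esub> r) \<in> int_powers B n"
        using subgroup.m_inv_closed[OF pw S[THEN conjunct2, THEN conjunct2, rule_format, OF h]] by simp
    qed (use S in auto)
    then show ?case by (rule exI)
  next
    case (eng r1 r2)
    from eng.IH(1) obtain S1 where S1: "?P S1 r1" ..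
    from eng.IH(2) obtain S2 where S2: "?P S2 r2" ..
    have mult: "h (r1 \<otimes>\<^bsub>?F\<^esub> r2) = h r1 \<otimes>\<^bsub>B\<^esub> h r2" if "h \<in> hom ?F B" for h
      using that gencarr[OF eng.hyps(1)] gencarr[OF eng.hyps(2)] by (simp add: hom_mult)
    have sub: "additive_mod G (generate G S1) n c" "additive_mod G (generate G S2) n c"
      if "additive_mod G (generate G (S1 \<union> S2)) n c" for n c
      by (rule additive_mod_mono[OF that], rule G.mono_generate, simp)+
    have "?P (S1 \<union> S2) (r1 \<otimes>\<^bsub>?F\<^esub> r2)"
    proof (intro conjI allI impI)
      fix c n h
      assume h: "additive_mod G (generate G (S1 \<union> S2)) n c \<and> h \<in> hom ?F B \<and>
       (\<forall>b\<in>carrier B. \<forall>t\<in>carrier ?T. h (frag_of (b, t)) = b [^]\<^bsub>B\<^esub> prod_eval c (tpow_rep t))"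
      then have "h r1 \<in> int_powers B n" "h r2 \<in> int_powers B n"
        using sub S1[THEN conjunct2, THEN conjunct2, rule_format, of n c h]
          S2[THEN conjunct2, THEN conjunct2, rule_format, of n c h] by simp_all
      moreover have "h (r1 \<otimes>\<^bsub>?F\<^esub> r2) = h r1 \<otimes>\<^bsub>B\<^esub> h r2" using h by (intro mult) simp
      ultimately show "h (r1 \<otimes>\<^bsub>?F\<^esub> r2) \<in> int_powers B n"
        using subgroup.m_closed[OF pw] by simp
    qed (use S1 S2 in auto)
    then show ?case by (rule exI)
  qed
qed

text \<open>Two supports are joined: \<open>S1\<close> puts the evaluation at the chosen
  representative of the coset into \<open>n B\<close>, and \<open>S2\<close> allows that
  representative to be replaced by \<open>frag_of xs\<close>, whose evaluation is the plain
  product.\<close>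

lemma tensor_tpow_vanishing:
  assumes G: "comm_group G" and B: "comm_group B" and b: "b \<in> carrier B"
    and xs: "length xs = k" "set xs \<subseteq> carrier G"
    and z: "frag_of (b, generate (tpow_free k G) (tpow_rels k G) #>\<^bsub>tpow_free k G\<^esub> frag_of xs)
              \<in> tensor_sub B (tensor_power k G)"
  shows "\<exists>S. finite S \<and> S \<subseteq> carrier G \<and>
    (\<forall>c n. additive_mod G (generate G S) n c \<longrightarrow> b [^]\<^bsub>B\<^esub> prod_list (map c xs) \<in> int_powers B n)"
proof -
  interpret G: comm_group G by fact
  interpret B: comm_group B by fact
  let ?T = "tensor_power k G"
  let ?N = "generate (tpow_free k G) (tpow_rels k G)"
  let ?t = "?N #>\<^bsub>tpow_free k G\<^esub> frag_of xs"
  have x: "frag_of xs \<in> carrier (tpow_free k G)" using xs by (simp add: tpow_free_def)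
  then have t: "?t \<in> carrier ?T" unfolding tensor_power_def carrier_FactGroup by blast
  from tensor_tpow_relation_finitely_supported[OF G B z] obtain S1 where
    S1: "finite S1 \<and> S1 \<subseteq> carrier G \<and>
    (\<forall>c n h. additive_mod G (generate G S1) n c \<and> h \<in> hom (tensor_free B ?T) B \<and>
       (\<forall>b\<in>carrier B. \<forall>t\<in>carrier ?T.
          h (frag_of (b, t)) = b [^]\<^bsub>B\<^esub> prod_eval c (tpow_rep t)) \<longrightarrow>
       h (frag_of (b, ?t)) \<in> int_powers B n)" ..
  obtain S2 where S2: "finite S2" "S2 \<subseteq> carrier G"
    "\<And>c n. additive_mod G (generate G S2) n c \<Longrightarrow> n dvd prod_eval c (tpow_rep ?t - frag_of xs)"
    using tpow_relation_finitely_supported[OF G tpow_rep_coset[OF G x]] by blast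
  have "b [^]\<^bsub>B\<^esub> prod_list (map c xs) \<in> int_powers B n"
    if "additive_mod G (generate G (S1 \<union> S2)) n c" for c n
  proof -
    have sub: "additive_mod G (generate G S1) n c" "additive_mod G (generate G S2) n c"
      by (rule additive_mod_mono[OF that], rule G.mono_generate, simp)+
    \<comment> \<open>The universal property of the free group supplies the evaluation map, whatever
      \<open>c\<close> is.\<close>
    obtain h where h: "h \<in> hom (free_Abelian_group (carrier B \<times> carrier ?T)) B"
      "\<And>x. x \<in> carrier B \<times> carrier ?T \<Longrightarrow> h (frag_of x) = (\<lambda>(b, t). b [^]\<^bsub>B\<^esub> prod_eval c (tpow_rep t)) x"
      using B.free_Abelian_group_universal[of "\<lambda>(b, t). b [^]\<^bsub>B\<^esub> prod_eval c (tpow_rep t)" "carrier B \<times> carrier ?T"]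
      by (auto simp: image_subset_iff)
    have 1: "b [^]\<^bsub>B\<^esub> prod_eval c (tpow_rep ?t) \<in> int_powers B n"
      using S1[THEN conjunct2, THEN conjunct2, rule_format, of n c h] sub(1) h b t
      by (simp add: tensor_free_def)
    have 2: "b [^]\<^bsub>B\<^esub> (prod_list (map c xs) - prod_eval c (tpow_rep ?t)) \<in> int_powers B n"
      by (rule B.int_pow_in_int_powers[OF b]) (use S2(3)[OF sub(2)] in \<open>simp add: dvd_diff_commute\<close>)
    show ?thesis
      using subgroup.m_closed[OF B.subgroup_int_powers 1 2] b by (simp add: B.int_pow_mult[symmetric])
  qed
  then show ?thesis using S1 S2 by (intro exI[of _ "S1 \<union> S2"]) blast
qed

section \<open>Pure tensors\<close>

definition pure_tensor :: "('b, 'd) monoid_scheme \<Rightarrow> ('g, 'e) monoid_scheme \<Rightarrow> 'b \<Rightarrow> 'g \<Rightarrow> ('b \<times> 'g \<Rightarrow>\<^sub>0 int) set" where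
  "pure_tensor B G b g = tensor_sub B G #>\<^bsub>tensor_free B G\<^esub> frag_of (b, g)"

lemma subgroup_tensor_sub:
  assumes "group B" "group G"
  shows "subgroup (tensor_sub B G) (tensor_free B G)"
  unfolding tensor_sub_def
  by (rule group.generate_is_subgroup[OF comm_group.axioms(2)[OF comm_group_tensor_free] tensor_rels_subset[OF assms]])

lemma comm_group_tensor:
  assumes "group B" "group G"
  shows "comm_group (tensor B G)"
  unfolding tensor_def
  by (rule comm_group.abelian_FactGroup[OF comm_group_tensor_free subgroup_tensor_sub[OF assms]])

lemma pure_tensor_closed:
  assumes "b \<in> carrier B" "g \<in> carrier G"
  shows "pure_tensor B G b g \<in> carrier (tensor B G)"
  using assms unfolding pure_tensor_def tensor_def carrier_FactGroup tensor_free_def by auto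

text \<open>Stated for pairs and an arbitrary relation of this shape, so that one proof serves
  additivity in both arguments.\<close>

lemma pure_tensor_add:
  assumes "group B" "group G" and x: "x \<in> carrier B \<times> carrier G" "y \<in> carrier B \<times> carrier G" "z \<in> carrier B \<times> carrier G"
    and r: "frag_of z - frag_of x - frag_of y \<in> tensor_rels B G"
  shows "pure_tensor B G (fst z) (snd z) =
    pure_tensor B G (fst x) (snd x) \<otimes>\<^bsub>tensor B G\<^esub> pure_tensor B G (fst y) (snd y)"
proof -
  interpret F: comm_group "tensor_free B G" by (rule comm_group_tensor_free)
  interpret N: subgroup "tensor_sub B G" "tensor_free B G"
    by (rule subgroup_tensor_sub) fact+
  interpret N: normal "tensor_sub B G" "tensor_free B G"
    by (rule F.subgroup_imp_normal[OF N.subgroup_axioms])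
  have c: "frag_of x \<in> carrier (tensor_free B G)" "frag_of y \<in> carrier (tensor_free B G)"
    using x unfolding tensor_free_def by auto
  then have xy: "frag_of x + frag_of y \<in> carrier (tensor_free B G)"
    using F.m_closed[OF c] by (simp add: tensor_free_def)
  have "frag_of z - frag_of x - frag_of y \<in> tensor_sub B G"
    unfolding tensor_sub_def by (rule generate.incl[OF r])
  moreover have "frag_of z = (frag_of z - frag_of x - frag_of y) \<otimes>\<^bsub>tensor_free B G\<^esub> (frag_of x + frag_of y)"
    by (simp add: tensor_free_def)
  ultimately have "frag_of z \<in> tensor_sub B G #>\<^bsub>tensor_free B G\<^esub> (frag_of x + frag_of y)"
    unfolding r_coset_def by blast
  then have "tensor_sub B G #>\<^bsub>tensor_free B G\<^esub> (frag_of x + frag_of y) = tensor_sub B G #>\<^bsub>tensor_free B G\<^esub> frag_of z"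
    by (rule F.repr_independence[OF _ xy N.subgroup_axioms])
  moreover have "tensor_sub B G #>\<^bsub>tensor_free B G\<^esub> frag_of x <#>\<^bsub>tensor_free B G\<^esub> (tensor_sub B G #>\<^bsub>tensor_free B G\<^esub> frag_of y)
      = tensor_sub B G #>\<^bsub>tensor_free B G\<^esub> (frag_of x + frag_of y)"
    using N.rcos_sum[OF c] by (simp add: tensor_free_def)
  ultimately show ?thesis unfolding pure_tensor_def tensor_def by simp
qed

lemma pure_tensor_hom_right:
  assumes "group B" "group G" "b \<in> carrier B"
  shows "group_hom G (tensor B G) (pure_tensor B G b)"
proof -
  interpret G: group G by fact
  have "pure_tensor B G b \<in> hom G (tensor B G)"
  proof (rule homI)
    fix x y assume x: "x \<in> carrier G" "y \<in> carrier G"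
    have "frag_of (b, x \<otimes>\<^bsub>G\<^esub> y) - frag_of (b, x) - frag_of (b, y) \<in> tensor_rels B G"
      unfolding tensor_rels_def using x assms(3) by blast
    then show "pure_tensor B G b (x \<otimes>\<^bsub>G\<^esub> y) = pure_tensor B G b x \<otimes>\<^bsub>tensor B G\<^esub> pure_tensor B G b y"
      using pure_tensor_add[OF assms(1,2), of "(b, x)" "(b, y)" "(b, x \<otimes>\<^bsub>G\<^esub> y)"] x assms(3) by simp
  qed (simp add: pure_tensor_closed assms)
  then show ?thesis
    using assms comm_group.axioms(2)[OF comm_group_tensor[OF assms(1,2)]]
    by (intro group_hom.intro group_hom_axioms.intro)
qed

lemma pure_tensor_hom_left:
  assumes "group B" "group G" "g \<in> carrier G"
  shows "group_hom B (tensor B G) (\<lambda>b. pure_tensor B G b g)"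
proof -
  interpret B: group B by fact
  have "(\<lambda>b. pure_tensor B G b g) \<in> hom B (tensor B G)"
  proof (rule homI)
    fix x y assume x: "x \<in> carrier B" "y \<in> carrier B"
    have "frag_of (x \<otimes>\<^bsub>B\<^esub> y, g) - frag_of (x, g) - frag_of (y, g) \<in> tensor_rels B G"
      unfolding tensor_rels_def using x assms(3) by blast
    then show "pure_tensor B G (x \<otimes>\<^bsub>B\<^esub> y) g = pure_tensor B G x g \<otimes>\<^bsub>tensor B G\<^esub> pure_tensor B G y g"
      using pure_tensor_add[OF assms(1,2), of "(x, g)" "(y, g)" "(x \<otimes>\<^bsub>B\<^esub> y, g)"] x assms(3) by simp
  qed (simp add: pure_tensor_closed assms)
  then show ?thesis
    using assms comm_group.axioms(2)[OF comm_group_tensor[OF assms(1,2)]]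
    by (intro group_hom.intro group_hom_axioms.intro)
qed

lemma pure_tensor_int_pow:
  assumes "group B" "group G" "b \<in> carrier B" "g \<in> carrier G"
  shows "pure_tensor B G (b [^]\<^bsub>B\<^esub> (n::int)) g = pure_tensor B G b (g [^]\<^bsub>G\<^esub> n)"
  using group_hom.hom_int_pow[OF pure_tensor_hom_right[OF assms(1,2,3)] assms(4), of n]
    group_hom.hom_int_pow[OF pure_tensor_hom_left[OF assms(1,2,4)] assms(3), of n] by simp

lemma pure_tensor_eq_one_iff:
  assumes "group B" "group G" "b \<in> carrier B" "g \<in> carrier G"
  shows "pure_tensor B G b g = \<one>\<^bsub>tensor B G\<^esub> \<longleftrightarrow> frag_of (b, g) \<in> tensor_sub B G"
proof -
  interpret F: comm_group "tensor_free B G" by (rule comm_group_tensor_free)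
  have N: "subgroup (tensor_sub B G) (tensor_free B G)" by (rule subgroup_tensor_sub) fact+
  have c: "frag_of (b, g) \<in> carrier (tensor_free B G)" using assms by (simp add: tensor_free_def)
  show ?thesis
    unfolding pure_tensor_def tensor_def one_FactGroup
    using F.coset_join1[OF _ c N] F.coset_join2[OF c N] subgroup.subset[OF N] by blast
qed

text \<open>Reduces the vanishing of \<open>b \<otimes> g\<close> to generators of a subgroup
  containing \<open>g\<close>.\<close>

lemma pure_tensor_kernel:
  assumes "group B" "group G" "b \<in> carrier B"
  shows "subgroup {g \<in> carrier G. pure_tensor B G b g = \<one>\<^bsub>tensor B G\<^esub>} G"
  using group_hom.subgroup_kernel[OF pure_tensor_hom_right[OF assms]] unfolding kernel_def .

text \<open>In additive terms \<open>b = n y\<close>, and the factor moves across the tensor sign: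
  \<open>n y \<otimes> s = y \<otimes> n s = 0\<close>.\<close>

lemma pure_tensor_divisible_torsion:
  assumes "group B" "group G" "b \<in> int_powers B n" "s \<in> carrier G" "s [^]\<^bsub>G\<^esub> (n::int) = \<one>\<^bsub>G\<^esub>"
  shows "pure_tensor B G b s = \<one>\<^bsub>tensor B G\<^esub>"
proof -
  obtain y where y: "y \<in> carrier B" "b = y [^]\<^bsub>B\<^esub> n" using assms(3) unfolding int_powers_def by blast
  then show ?thesis
    using pure_tensor_int_pow[OF assms(1,2) y(1) assms(4), of n] assms(5)
      group_hom.hom_one[OF pure_tensor_hom_right[OF assms(1,2) y(1)]] by simp
qed

text \<open>What the vanishing of \<open>b \<otimes> g \<otimes> \<dots> \<otimes> g\<close> says about coordinates, in a form that is closed under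
  replacing \<open>b\<close> by its powers.\<close>

definition powers_vanish :: "nat \<Rightarrow> ('b, 'd) monoid_scheme \<Rightarrow> ('g, 'e) monoid_scheme \<Rightarrow> 'b \<Rightarrow> bool" where
  "powers_vanish k B G b \<longleftrightarrow> (\<forall>g\<in>carrier G. \<exists>S. finite S \<and> S \<subseteq> carrier G \<and> g \<in> S \<and>
     (\<forall>c n. additive_mod G (generate G S) n c \<longrightarrow> b [^]\<^bsub>B\<^esub> (c g ^ k) \<in> int_powers B n))"

text \<open>Uses the constant list, whose product of coordinates is \<open>c g ^ k\<close>.
  Adjoining \<open>g\<close> to the support lets \<open>g\<close> be expanded in the coordinates of
  the span.\<close>

lemma powers_vanishI:
  assumes G: "comm_group G" and B: "comm_group B" and b: "b \<in> carrier B"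
    and van: "\<And>t. t \<in> carrier (tensor_power k G) \<Longrightarrow> frag_of (b, t) \<in> tensor_sub B (tensor_power k G)"
  shows "powers_vanish k B G b"
  unfolding powers_vanish_def
proof
  interpret G: comm_group G by fact
  fix g assume g: "g \<in> carrier G"
  let ?t = "generate (tpow_free k G) (tpow_rels k G) #>\<^bsub>tpow_free k G\<^esub> frag_of (replicate k g)"
  have xs: "length (replicate k g) = k" "set (replicate k g) \<subseteq> carrier G" using g by auto
  then have "?t \<in> carrier (tensor_power k G)"
    unfolding tensor_power_def carrier_FactGroup by (simp add: tpow_free_def)
  from tensor_tpow_vanishing[OF G B b xs van[OF this]]
  obtain S where S: "finite S" "S \<subseteq> carrier G"
    "\<And>c n. additive_mod G (generate G S) n c \<Longrightarrow> b [^]\<^bsub>B\<^esub> prod_list (map c (replicate k g)) \<in> int_powers B n"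
    by blast
  have "b [^]\<^bsub>B\<^esub> (c g ^ k) \<in> int_powers B n" if "additive_mod G (generate G (insert g S)) n c" for c n
    using S(3)[OF additive_mod_mono[OF that G.mono_generate]] by (simp add: prod_list_replicate subset_insertI)
  then show "\<exists>S. finite S \<and> S \<subseteq> carrier G \<and> g \<in> S \<and>
     (\<forall>c n. additive_mod G (generate G S) n c \<longrightarrow> b [^]\<^bsub>B\<^esub> (c g ^ k) \<in> int_powers B n)"
    using S(1,2) g by (intro exI[of _ "insert g S"]) simp
qed

lemma powers_vanish_int_pow:
  assumes B: "comm_group B" and b: "b \<in> carrier B" and pv: "powers_vanish k B G b"
  shows "powers_vanish k B G (b [^]\<^bsub>B\<^esub> (m::int))"
proof -
  interpret B: comm_group B by fact
  have pow: "(b [^]\<^bsub>B\<^esub> m) [^]\<^bsub>B\<^esub> e \<in> int_powers B n" if "b [^]\<^bsub>B\<^esub> e \<in> int_powers B n" for e n :: int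
  proof -
    have "(b [^]\<^bsub>B\<^esub> m) [^]\<^bsub>B\<^esub> e = (b [^]\<^bsub>B\<^esub> e) [^]\<^bsub>B\<^esub> m"
      using b by (simp add: B.int_pow_pow mult.commute)
    then show ?thesis
      using B.subgroup_int_pow_closed[OF B.subgroup_int_powers that] by simp
  qed
  show ?thesis
    unfolding powers_vanish_def
  proof
    fix g assume "g \<in> carrier G"
    from bspec[OF pv[unfolded powers_vanish_def] this] obtain S where "finite S \<and> S \<subseteq> carrier G \<and> g \<in> S \<and>
      (\<forall>c n. additive_mod G (generate G S) n c \<longrightarrow> b [^]\<^bsub>B\<^esub> (c g ^ k) \<in> int_powers B n)" ..
    then show "\<exists>S. finite S \<and> S \<subseteq> carrier G \<and> g \<in> S \<and> (\<forall>c n. additive_mod G (generate G S) n c \<longrightarrow>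
      (b [^]\<^bsub>B\<^esub> m) [^]\<^bsub>B\<^esub> (c g ^ k) \<in> int_powers B n)"
      using pow by (intro exI[of _ S]) simp
  qed
qed

text \<open>The span of the finite support has cyclic coordinates, and each of them may be inserted
  for \<open>c\<close>. Afterwards the support is forgotten; only a generator \<open>s\<close>, its
  modulus \<open>n\<close> and the coordinate \<open>e\<close> of \<open>g\<close> remain.\<close>

lemma powers_vanish_coords:
  assumes G: "comm_group G" and pv: "powers_vanish k B G b" and g: "g \<in> carrier G"
  shows "g \<in> generate G {s [^]\<^bsub>G\<^esub> e | s (n::int) (e::int).
    s \<in> carrier G \<and> s [^]\<^bsub>G\<^esub> n = \<one>\<^bsub>G\<^esub> \<and> b [^]\<^bsub>B\<^esub> (e ^ k) \<in> int_powers B n}" (is "_ \<in> generate G ?Y")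
proof -
  interpret G: comm_group G by fact
  from bspec[OF pv[unfolded powers_vanish_def] g] obtain S where S: "finite S" "S \<subseteq> carrier G" "g \<in> S"
    and van: "\<forall>c n. additive_mod G (generate G S) n c \<longrightarrow> b [^]\<^bsub>B\<^esub> (c g ^ k) \<in> int_powers B n"
    by (elim exE conjE)
  let ?X = "{s [^]\<^bsub>G\<^esub> c g | s n c. s \<in> generate G S \<and> s [^]\<^bsub>G\<^esub> (n::int) = \<one>\<^bsub>G\<^esub> \<and> additive_mod G (generate G S) n c}"
  have "g \<in> generate G ?X"
    using bspec[OF G.cyclic_coords_generate[OF S(1,2), unfolded cyclic_coords_def] generate.incl[OF S(3)]] .
  moreover have "?X \<subseteq> ?Y"
  proof
    fix v assume "v \<in> ?X"
    then obtain s c and n :: int where s: "s \<in> generate G S" "s [^]\<^bsub>G\<^esub> n = \<one>\<^bsub>G\<^esub>"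
      and c: "additive_mod G (generate G S) n c" and v: "v = s [^]\<^bsub>G\<^esub> c g"
      by (elim CollectE exE conjE)
    have "s \<in> carrier G" using G.generate_in_carrier[OF S(2) s(1)] .
    with s(2) v van[rule_format, OF c] show "v \<in> ?Y" by blast
  qed
  ultimately show ?thesis using G.mono_generate by blast
qed

section \<open>The case of an element of infinite order\<close>

lemma torsion_powers_vanish:
  assumes G: "comm_group G" and B: "comm_group B"
    and "N > 0" "b \<in> carrier B" "b [^]\<^bsub>B\<^esub> int N = \<one>\<^bsub>B\<^esub>" "powers_vanish k B G b" "g \<in> carrier G"
  shows "pure_tensor B G b g = \<one>\<^bsub>tensor B G\<^esub>"
  using assms(3-)
proof (induction N arbitrary: b g rule: less_induct)
  case (less N b g)
  interpret G: comm_group G by fact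
  interpret B: comm_group B by fact
  note b = \<open>b \<in> carrier B\<close> and g = \<open>g \<in> carrier G\<close>
  let ?X = "{s [^]\<^bsub>G\<^esub> e | s (n::int) (e::int).
    s \<in> carrier G \<and> s [^]\<^bsub>G\<^esub> n = \<one>\<^bsub>G\<^esub> \<and> b [^]\<^bsub>B\<^esub> (e ^ k) \<in> int_powers B n}"
  \<comment> \<open>As \<open>?K\<close> is a subgroup, it is enough to show that each cyclic
    component \<open>s [^] e\<close> of \<open>g\<close> lies in it.\<close>
  let ?K = "{g \<in> carrier G. pure_tensor B G b g = \<one>\<^bsub>tensor B G\<^esub>}"
  have "g \<in> generate G ?X" by (rule powers_vanish_coords[OF G less.prems(4) g])
  moreover have "?X \<subseteq> ?K"
  proof
    fix v assume "v \<in> ?X"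
    then obtain s and n e :: int where sc: "s \<in> carrier G" and s: "s [^]\<^bsub>G\<^esub> n = \<one>\<^bsub>G\<^esub>"
      and van: "b [^]\<^bsub>B\<^esub> (e ^ k) \<in> int_powers B n" and v: "v = s [^]\<^bsub>G\<^esub> e"
      by (elim CollectE exE conjE)
    have "pure_tensor B G b v = \<one>\<^bsub>tensor B G\<^esub>"
    proof (cases "coprime (e) (int N)")
      case False
      define p where "p = nat (gcd (e) (int N))"
      have p: "int p = gcd (e) (int N)" unfolding p_def by simp
      have "p > 1"
        using False less.prems(1) p 
        by (cases "p = 0"; cases "p = 1") (auto simp: coprime_iff_gcd_eq_1)
      have "p dvd N" using p by (metis gcd_dvd2 int_dvd_int_iff)
      then obtain M where M: "N = p * M" by blast
      have "M < N" "M > 0" using M \<open>p > 1\<close> less.prems(1) by auto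
      moreover have "(b [^]\<^bsub>B\<^esub> int p) [^]\<^bsub>B\<^esub> int M = \<one>\<^bsub>B\<^esub>"
        using less.prems(3) b M by (simp add: B.int_pow_pow)
      \<comment> \<open>The smaller exponent \<open>M\<close> kills the \<open>p\<close>-th power of
        \<open>b\<close>. The induction hypothesis is wanted for all \<open>h\<close>, since it is
        applied to \<open>s [^] q\<close> rather than to \<open>g\<close>.\<close>
      ultimately have IH: "pure_tensor B G (b [^]\<^bsub>B\<^esub> int p) h = \<one>\<^bsub>tensor B G\<^esub>" if "h \<in> carrier G" for h
        using less.IH[of M "b [^]\<^bsub>B\<^esub> int p" h] that b powers_vanish_int_pow[OF B b less.prems(4)] by simp
      obtain q where q: "e = q * int p" using p by (metis gcd_dvd1 dvd_def mult.commute)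
      have "v = (s [^]\<^bsub>G\<^esub> q) [^]\<^bsub>G\<^esub> int p" unfolding v q using sc by (simp add: G.int_pow_pow)
      then show ?thesis
        using IH[of "s [^]\<^bsub>G\<^esub> q"] pure_tensor_int_pow[OF B.is_group G.is_group b, of "s [^]\<^bsub>G\<^esub> q" "int p"] sc by simp
    next
      case True
      \<comment> \<open>Coprimality passes to \<open>e ^ k\<close>, so Bezout writes
        \<open>b\<close> as a power of \<open>b [^] (e ^ k)\<close>; the contribution of
        \<open>N\<close> vanishes.\<close>
      then have "coprime (e ^ k) (int N)" by simp
      then obtain u w where uw: "u * e ^ k + w * int N = 1"
        using bezout_int[of "e ^ k" "int N"] by auto
      have "b = b [^]\<^bsub>B\<^esub> (u * e ^ k + w * int N)" using uw b by simp
      also have "\<dots> = (b [^]\<^bsub>B\<^esub> (e ^ k)) [^]\<^bsub>B\<^esub> u \<otimes>\<^bsub>B\<^esub> (b [^]\<^bsub>B\<^esub> int N) [^]\<^bsub>B\<^esub> w"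
        using b by (simp add: B.int_pow_mult B.int_pow_pow mult.commute)
      also have "\<dots> = (b [^]\<^bsub>B\<^esub> (e ^ k)) [^]\<^bsub>B\<^esub> u" using less.prems(3) b by simp
      also have "\<dots> \<in> int_powers B n"
        by (rule B.subgroup_int_pow_closed[OF B.subgroup_int_powers van])
      finally have "pure_tensor B G b s = \<one>\<^bsub>tensor B G\<^esub>"
        using pure_tensor_divisible_torsion[OF B.is_group G.is_group _ sc s] by blast
      then have "s \<in> ?K" using sc by simp
      from G.subgroup_int_pow_closed[OF pure_tensor_kernel[OF B.is_group G.is_group b] this]
      show ?thesis unfolding v by simp
    qed
    then show "v \<in> ?K" unfolding v using sc by simp
  qed
  ultimately show ?case
    using G.generate_subgroup_incl[OF _ pure_tensor_kernel[OF B.is_group G.is_group b]] by blast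
qed

lemma (in comm_group) torsion_subgroup: "subgroup {x \<in> carrier G. \<exists>m::int. m \<noteq> 0 \<and> x [^] m = \<one>} G" (is "subgroup ?T G")
proof (rule subgroupI)
  have "\<one> \<in> ?T" by (auto intro: exI[of _ 1])
  then show "?T \<noteq> {}" by blast
next
  fix x assume "x \<in> ?T"
  then obtain m :: int where "x \<in> carrier G" "m \<noteq> 0" "x [^] m = \<one>" by blast
  then have "inv x \<in> carrier G" "m \<noteq> 0" "inv x [^] m = \<one>" by (auto simp: int_pow_inv)
  then show "inv x \<in> ?T" by blast
next
  fix x y assume "x \<in> ?T" "y \<in> ?T"
  then obtain m n :: int where x: "x \<in> carrier G" "m \<noteq> 0" "x [^] m = \<one>"
    and y: "y \<in> carrier G" "n \<noteq> 0" "y [^] n = \<one>" by blast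
  have "(x \<otimes> y) [^] (m * n) = (x [^] m) [^] n \<otimes> (y [^] n) [^] m"
    using x(1) y(1) by (simp add: int_pow_distrib int_pow_pow mult.commute)
  then have "x \<otimes> y \<in> carrier G" "m * n \<noteq> 0" "(x \<otimes> y) [^] (m * n) = \<one>" using x y by auto
  then show "x \<otimes> y \<in> ?T" by blast
qed auto

text \<open>The torsion elements form a subgroup that misses \<open>x\<close>, so some component
  \<open>s [^] e\<close> is not torsion. As \<open>s [^] n = \<one>\<close>, this forces
  \<open>n = 0\<close> and \<open>e \<noteq> 0\<close>. Since \<open>0 B\<close> is trivial, the
  nonzero exponent \<open>e ^ k\<close> kills \<open>b\<close>.\<close>

lemma infinite_order_powers_vanish:
  assumes G: "comm_group G" and B: "comm_group B" and b: "b \<in> carrier B"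
    and pv: "powers_vanish k B G b" and x: "x \<in> carrier G" "group.ord G x = 0"
  shows "\<exists>N>0. b [^]\<^bsub>B\<^esub> int N = \<one>\<^bsub>B\<^esub>"
proof -
  interpret G: comm_group G by fact
  interpret B: comm_group B by fact
  let ?X = "{s [^]\<^bsub>G\<^esub> e | s (n::int) (e::int).
    s \<in> carrier G \<and> s [^]\<^bsub>G\<^esub> n = \<one>\<^bsub>G\<^esub> \<and> b [^]\<^bsub>B\<^esub> (e ^ k) \<in> int_powers B n}"
  let ?T = "{x \<in> carrier G. \<exists>m::int. m \<noteq> 0 \<and> x [^]\<^bsub>G\<^esub> m = \<one>\<^bsub>G\<^esub>}"
  have "x \<in> generate G ?X" by (rule powers_vanish_coords[OF G pv x(1)])
  moreover have "x \<notin> ?T" using x G.int_pow_eq_id by auto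
  ultimately have "\<not> ?X \<subseteq> ?T"
    using G.generate_subgroup_incl[OF _ G.torsion_subgroup] by blast
  then obtain v where "v \<in> ?X" "v \<notin> ?T" by blast
  then obtain s and n e :: int where sc: "s \<in> carrier G" and s: "s [^]\<^bsub>G\<^esub> n = \<one>\<^bsub>G\<^esub>"
      and van: "b [^]\<^bsub>B\<^esub> (e ^ k) \<in> int_powers B n" and v: "s [^]\<^bsub>G\<^esub> e \<notin> ?T"
      by (elim CollectE exE conjE) simp
  have "(s [^]\<^bsub>G\<^esub> e) [^]\<^bsub>G\<^esub> n = (s [^]\<^bsub>G\<^esub> n) [^]\<^bsub>G\<^esub> e"
    using sc by (simp add: G.int_pow_pow mult.commute)
  then have n: "n = 0" using v s sc by auto
  have "e \<noteq> 0"
  proof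
    assume "e = 0"
    then have "s [^]\<^bsub>G\<^esub> e \<in> ?T" by (auto intro: exI[of _ 1])
    then show False using v by blast
  qed
  then have e: "e ^ k \<noteq> 0" by simp
  have "b [^]\<^bsub>B\<^esub> (e ^ k) = \<one>\<^bsub>B\<^esub>"
    using van unfolding n int_powers_def by auto
  then have "b [^]\<^bsub>B\<^esub> \<bar>e ^ k\<bar> = \<one>\<^bsub>B\<^esub>"
    using b by (auto simp: abs_if B.int_pow_neg)
  then show ?thesis using e by (intro exI[of _ "nat \<bar>e ^ k\<bar>"]) simp
qed

section \<open>Direct sums of cyclic groups\<close>

text \<open>An element of a direct sum has finite support, so it is a finite product of its
  components; \<open>cut\<close> assembles it one index at a time.\<close>

lemma subgroup_sum_group_memI:
  assumes H: "\<And>i. i \<in> I \<Longrightarrow> group (H i)"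
    and K: "subgroup K (sum_group I H)" and p: "p \<in> carrier (sum_group I H)"
    and comp: "\<And>i. i \<in> I \<Longrightarrow> (\<lambda>j\<in>I. if j = i then p i else \<one>\<^bsub>H j\<^esub>) \<in> K"
  shows "p \<in> K"
proof -
  have pc: "p \<in> (\<Pi>\<^sub>E i\<in>I. carrier (H i))" and fin: "finite {i \<in> I. p i \<noteq> \<one>\<^bsub>H i\<^esub>}"
    using p carrier_sum_group[of I H, OF H] by auto
  have cut: "(\<lambda>j\<in>I. if j \<in> E then p j else \<one>\<^bsub>H j\<^esub>) \<in> K" if "finite E" "E \<subseteq> I" for E
    using that
  proof (induction E rule: finite_induct)
    case empty
    then show ?case using subgroup.one_closed[OF K] by (simp add: restrict_def)
  next
    case (insert i E)
    have "(\<lambda>j\<in>I. if j \<in> insert i E then p j else \<one>\<^bsub>H j\<^esub>) =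
      (\<lambda>j\<in>I. if j = i then p i else \<one>\<^bsub>H j\<^esub>) \<otimes>\<^bsub>sum_group I H\<^esub> (\<lambda>j\<in>I. if j \<in> E then p j else \<one>\<^bsub>H j\<^esub>)"
      using insert pc H by (fastforce simp: PiE_iff group.is_monoid intro!: restrict_ext)
    moreover have "i \<in> I" "E \<subseteq> I" using insert.prems by auto
    ultimately show ?case using subgroup.m_closed[OF K comp insert.IH] by (simp only:)
  qed
  have eq: "p = (\<lambda>j\<in>I. if j \<in> {i \<in> I. p i \<noteq> \<one>\<^bsub>H i\<^esub>} then p j else \<one>\<^bsub>H j\<^esub>)"
    using pc by (auto simp: PiE_iff extensional_def)
  show ?thesis by (subst eq, rule cut[OF fin]) auto
qed

lemma sum_group_inclusion_hom:
  assumes H: "\<And>i. i \<in> I \<Longrightarrow> group (H i)" and i: "i \<in> I"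
  shows "(\<lambda>h. \<lambda>j\<in>I. if j = i then h else \<one>\<^bsub>H j\<^esub>) \<in> hom (H i) (sum_group I H)"
proof (rule homI)
  fix h assume "h \<in> carrier (H i)"
  moreover have "{j \<in> I. j = i \<and> h \<noteq> \<one>\<^bsub>H j\<^esub>} \<subseteq> {i}" by auto
  ultimately show "(\<lambda>j\<in>I. if j = i then h else \<one>\<^bsub>H j\<^esub>) \<in> carrier (sum_group I H)"
    using H by (auto simp: carrier_sum_group group.is_monoid monoid.one_closed
        intro: finite_subset[of _ "{i}"])
next
  fix x y
  show "(\<lambda>j\<in>I. if j = i then x \<otimes>\<^bsub>H i\<^esub> y else \<one>\<^bsub>H j\<^esub>) =
    (\<lambda>j\<in>I. if j = i then x else \<one>\<^bsub>H j\<^esub>) \<otimes>\<^bsub>sum_group I H\<^esub> (\<lambda>j\<in>I. if j = i then y else \<one>\<^bsub>H j\<^esub>)"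
    using H by (auto simp: group.is_monoid intro!: restrict_ext)
qed

text \<open>The decomposition of \<open>G\<close> itself provides coordinates that are additive on
  the whole group. Vanishing is checked on one summand at a time, through the subgroup
  \<open>?K\<close> of the direct sum.\<close>

lemma direct_sum_powers_vanish:
  fixes G :: "('g, 'e) monoid_scheme"
  assumes G: "comm_group G" and B: "comm_group B" and ds: "direct_sum_of_cyclic G"
    and b: "b \<in> carrier B" and pv: "powers_vanish k B G b" and g: "g \<in> carrier G"
  shows "pure_tensor B G b g = \<one>\<^bsub>tensor B G\<^esub>"
proof -
  interpret G: comm_group G by fact
  interpret B: comm_group B by fact
  obtain I where I: "I \<subseteq> carrier G" and "G \<cong> sum_group I (\<lambda>s. subgroup_generated G {s})"
    using ds unfolding direct_sum_of_cyclic_def by blast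
  then obtain \<phi> where \<phi>: "\<phi> \<in> iso G (sum_group I (\<lambda>s. subgroup_generated G {s}))"
    unfolding is_iso_def by blast
  let ?H = "\<lambda>s. subgroup_generated G {s}"
  let ?P = "sum_group I ?H"
  have Hg: "group (?H s)" for s by simp
  interpret P: group ?P by (rule sum_group) simp
  define \<psi> where "\<psi> = inv_into (carrier G) \<phi>"
  have \<psi>: "\<psi> \<in> iso ?P G" unfolding \<psi>_def by (rule G.iso_set_sym[OF \<phi>])
  have \<phi>\<psi>: "\<phi> (\<psi> p) = p" if "p \<in> carrier ?P" for p
    using \<phi> that unfolding \<psi>_def iso_def by (auto simp: bij_betw_inv_into_right)
  have \<psi>\<phi>: "\<psi> (\<phi> x) = x" if "x \<in> carrier G" for x
    using \<phi> that unfolding \<psi>_def iso_def by (auto simp: bij_betw_inv_into_left)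
  interpret \<phi>: group_hom G ?P \<phi>
    using \<phi> by (intro group_hom.intro group_hom_axioms.intro G.is_group P.is_group) (simp add: iso_def)
  interpret \<psi>: group_hom ?P G \<psi>
    using \<psi> by (intro group_hom.intro group_hom_axioms.intro G.is_group P.is_group) (simp add: iso_def)
  let ?K = "{p \<in> carrier ?P. pure_tensor B G b (\<psi> p) = \<one>\<^bsub>tensor B G\<^esub>}"
  interpret \<tau>: group_hom G "tensor B G" "pure_tensor B G b"
    by (rule pure_tensor_hom_right[OF B.is_group G.is_group b])
  have "pure_tensor B G b \<circ> \<psi> \<in> hom ?P (tensor B G)"
    by (rule hom_compose[OF \<psi>.homh \<tau>.homh])
  then interpret \<tau>\<psi>: group_hom ?P "tensor B G" "pure_tensor B G b \<circ> \<psi>"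
    by (intro group_hom.intro group_hom_axioms.intro P.is_group \<tau>.H.is_group)
  have K: "subgroup ?K ?P" using \<tau>\<psi>.subgroup_kernel unfolding kernel_def by simp
  have "(\<lambda>j\<in>I. if j = s then \<phi> g s else \<one>\<^bsub>?H j\<^esub>) \<in> ?K" if s: "s \<in> I" for s
  proof -
    define \<iota> where "\<iota> h = (\<lambda>j\<in>I. if j = s then h else \<one>\<^bsub>?H j\<^esub>)" for h
    have "\<iota> \<in> hom (?H s) ?P"
      unfolding \<iota>_def by (rule sum_group_inclusion_hom[OF Hg s])
    then interpret \<iota>: group_hom "?H s" ?P \<iota>
      by (intro group_hom.intro group_hom_axioms.intro P.is_group Hg)
    have sG: "s \<in> carrier G" using s I by blast
    have sH: "s \<in> carrier (?H s)" using G.subgroup_generated_subset_carrier_subset[of "{s}"] sG by simp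
    have Hs: "carrier (?H s) = range (\<lambda>n::int. s [^]\<^bsub>G\<^esub> n)"
      by (rule G.carrier_subgroup_generated_by_singleton[OF sG])
    \<comment> \<open>The coordinate of \<open>x\<close> in the summand of \<open>s\<close>: an
      exponent of \<open>s\<close>, determined only modulo the order of \<open>s\<close>.\<close>
    define c where "c x = (SOME m::int. \<phi> x s = s [^]\<^bsub>G\<^esub> m)" for x
    have \<phi>s: "\<phi> x s \<in> carrier (?H s)" if "x \<in> carrier G" for x
      using \<phi>.hom_closed[OF that] s by (auto simp: carrier_sum_group PiE_iff)
    have c: "\<phi> x s = s [^]\<^bsub>G\<^esub> c x" if "x \<in> carrier G" for x
    proof -
      have "\<exists>m::int. \<phi> x s = s [^]\<^bsub>G\<^esub> m" using \<phi>s[OF that] unfolding Hs by blast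
      then show ?thesis unfolding c_def by (rule someI_ex)
    qed
    \<comment> \<open>\<open>G.ord\<close> is 0 for elements of infinite order, which matches the
      convention for the modulus.\<close>
    define n where "n = int (G.ord s)"
    have add: "additive_mod G (carrier G) n c"
      unfolding additive_mod_def
    proof (intro ballI)
      fix x y assume xy: "x \<in> carrier G" "y \<in> carrier G"
      have "s [^]\<^bsub>G\<^esub> c (x \<otimes>\<^bsub>G\<^esub> y) = \<phi> (x \<otimes>\<^bsub>G\<^esub> y) s"
        by (rule c[symmetric]) (use xy in simp)
      also have "\<dots> = s [^]\<^bsub>G\<^esub> (c x + c y)"
        using xy s sG c[OF xy(1)] c[OF xy(2)] by (simp add: \<phi>.hom_mult G.int_pow_mult)
      finally show "n dvd c (x \<otimes>\<^bsub>G\<^esub> y) - c x - c y"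
        using G.int_pow_eq[OF sG] unfolding n_def by (simp add: algebra_simps dvd_diff_commute)
    qed
    \<comment> \<open>The isomorphism is arbitrary, so the element of \<open>G\<close> that
      generates the summand indexed by \<open>s\<close> is \<open>u\<close>, which may differ from
      \<open>s\<close>.\<close>
    define u where "u = \<psi> (\<iota> s)"
    have u: "u \<in> carrier G" unfolding u_def using sH by simp
    have upow: "\<psi> (\<iota> (s [^]\<^bsub>G\<^esub> m)) = u [^]\<^bsub>G\<^esub> m" for m :: int
      using \<iota>.hom_int_pow[OF sH, of m] \<psi>.hom_int_pow[of "\<iota> s" m] sH
      by (simp add: u_def G.int_pow_subgroup_generated)
    have un: "u [^]\<^bsub>G\<^esub> n = \<one>\<^bsub>G\<^esub>"
    proof -
      have "s [^]\<^bsub>G\<^esub> n = \<one>\<^bsub>?H s\<^esub>" using G.int_pow_eq_id[OF sG] unfolding n_def by simp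
      then show ?thesis using upow[of n] \<iota>.hom_one \<psi>.hom_one by simp
    qed
    have "s [^]\<^bsub>G\<^esub> c u = s [^]\<^bsub>G\<^esub> (1::int)"
    proof -
      have "\<phi> u = \<iota> s" unfolding u_def by (rule \<phi>\<psi>) (rule \<iota>.hom_closed[OF sH])
      then show ?thesis using c[OF u] s sG by (simp add: \<iota>_def)
    qed
    then have "n dvd c u - 1" using G.int_pow_eq[OF sG] unfolding n_def by (simp add: dvd_diff_commute)
    \<comment> \<open>Since \<open>c u\<close> is 1 modulo \<open>n\<close>, so is its
      \<open>k\<close>-th power. Hence \<open>b\<close> differs from \<open>b [^] (c u ^ k)\<close>
      by an \<open>n\<close>-th power and lies in \<open>n B\<close>.\<close>
    then have cu: "n dvd 1 - c u ^ k"
      by (metis dvd_trans dvd_diff_commute power_diff_1_eq dvd_triv_left)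
    from bspec[OF pv[unfolded powers_vanish_def] u] obtain S where S: "S \<subseteq> carrier G"
      and van: "\<forall>c n. additive_mod G (generate G S) n c \<longrightarrow> b [^]\<^bsub>B\<^esub> (c u ^ k) \<in> int_powers B n"
      by (elim exE conjE)
    have "b [^]\<^bsub>B\<^esub> (c u ^ k) \<in> int_powers B n"
      using van[rule_format, OF additive_mod_mono[OF add G.generate_incl[OF S]]] .
    from subgroup.m_closed[OF B.subgroup_int_powers this B.int_pow_in_int_powers[OF b cu]]
    have "b \<in> int_powers B n" using b by (simp add: B.int_pow_mult[symmetric])
    then have "pure_tensor B G b u = \<one>\<^bsub>tensor B G\<^esub>"
      by (rule pure_tensor_divisible_torsion[OF B.is_group G.is_group _ u un])
    then have "pure_tensor B G b (\<psi> (\<iota> (\<phi> g s))) = \<one>\<^bsub>tensor B G\<^esub>"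
      using c[OF g] upow u by (simp add: \<tau>.hom_int_pow)
    moreover have "\<iota> (\<phi> g s) \<in> carrier ?P" using \<phi>s[OF g] by simp
    ultimately show ?thesis unfolding \<iota>_def by simp
  qed
  then have "\<phi> g \<in> ?K"
    using subgroup_sum_group_memI[OF Hg K \<phi>.hom_closed[OF g]] by blast
  then show ?thesis using \<psi>\<phi>[OF g] by simp
qed

section \<open>Nontrivial maps on tensor products\<close>

text \<open>Pure tensors generate: if all \<open>f a \<otimes> g\<close> vanished, the linear
  extension would send the whole free group into the relations, and the map would be
  trivial.\<close>

lemma nontrivial_tensor_mapD:
  assumes A: "comm_group A" and B: "comm_group B" and G: "comm_group G"
    and nt: "nontrivial_map (tensor A G) (tensor B G) (tensor_map A G B G f (\<lambda>x. x))"
  shows "\<exists>a\<in>carrier A. \<exists>g\<in>carrier G. frag_of (f a, g) \<notin> tensor_sub B G"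
proof (rule ccontr)
  assume "\<not> ?thesis"
  then have all: "frag_of (f a, g) \<in> tensor_sub B G" if "a \<in> carrier A" "g \<in> carrier G" for a g
    using that by blast
  interpret A: comm_group A by fact
  interpret B: comm_group B by fact
  interpret G: comm_group G by fact
  interpret F: comm_group "tensor_free B G" by (rule comm_group_tensor_free)
  have N: "subgroup (tensor_sub B G) (tensor_free B G)"
    by (rule subgroup_tensor_sub[OF B.is_group G.is_group])
  have NA: "subgroup (tensor_sub A G) (tensor_free A G)"
    by (rule subgroup_tensor_sub[OF A.is_group G.is_group])
  let ?h = "frag_extend (\<lambda>(a, c). frag_of (f a, c))"
  have ext: "frag_extend (\<lambda>(a, c). frag_of (f a, c)) x \<in> tensor_sub B G"
    if "x \<in> carrier (tensor_free A G)" for x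
  proof -
    have "Poly_Mapping.keys x \<subseteq> carrier A \<times> carrier G" using that by (simp add: tensor_free_def)
    then show ?thesis
    proof (rule free_Abelian_group_induct)
      show "?h 0 \<in> tensor_sub B G" using subgroup.one_closed[OF N] by (simp add: tensor_free_def)
    next
      fix x y assume x: "?h x \<in> tensor_sub B G" and y: "?h y \<in> tensor_sub B G"
      have "?h y \<in> carrier (tensor_free B G)" using subgroup.mem_carrier[OF N y] .
      then have "inv\<^bsub>tensor_free B G\<^esub> (?h y) = - ?h y" by (simp add: tensor_free_def)
      then have "?h x - ?h y \<in> tensor_sub B G"
        using subgroup.m_closed[OF N x subgroup.m_inv_closed[OF N y]] by (simp add: tensor_free_def)
      then show "?h (x - y) \<in> tensor_sub B G" by (simp add: frag_extend_diff)
    next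
      fix p assume "p \<in> carrier A \<times> carrier G"
      then show "?h (frag_of p) \<in> tensor_sub B G" using all by auto
    qed
  qed
  obtain Z where Z: "Z \<in> carrier (tensor A G)" "tensor_map A G B G f (\<lambda>x. x) Z \<noteq> tensor_sub B G"
    using nt unfolding nontrivial_map_def by (auto simp: tensor_def)
  obtain z where z: "z \<in> carrier (tensor_free A G)" "Z = tensor_sub A G #>\<^bsub>tensor_free A G\<^esub> z"
    using Z(1) unfolding tensor_def carrier_FactGroup by blast
  interpret FA: comm_group "tensor_free A G" by (rule comm_group_tensor_free)
  have Zc: "Z \<subseteq> carrier (tensor_free A G)"
    unfolding z(2) by (rule FA.r_coset_subset_G[OF subgroup.subset[OF NA] z(1)])
  have zZ: "z \<in> Z" unfolding z(2) by (rule FA.rcos_self[OF z(1) NA])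
  \<comment> \<open>\<open>tensor_map\<close> is a union of cosets over all representatives in
    \<open>Z\<close>, so each of them has to be the trivial coset; \<open>zZ\<close> ensures that
    the union is not empty.\<close>
  have "tensor_sub B G #>\<^bsub>tensor_free B G\<^esub> frag_extend (\<lambda>(a, c). frag_of (f a, c)) x = tensor_sub B G"
    if "x \<in> Z" for x
    using ext[of x] Zc that F.coset_join2[OF subgroup.mem_carrier[OF N] N] by blast
  then have "tensor_map A G B G f (\<lambda>x. x) Z = tensor_sub B G"
    unfolding tensor_map_def using zZ by auto
  with Z(2) show False ..
qed

text \<open>The image of the class of \<open>(a, t)\<close> contains
  \<open>frag_of (f a, t)\<close>, while the identity of the target is
  \<open>tensor_sub B G\<close>; this one element separates the two sets.\<close>

lemma nontrivial_tensor_mapI: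
  assumes A: "comm_group A" and B: "comm_group B" and G: "comm_group G"
    and f: "f \<in> hom A B" and a: "a \<in> carrier A" and t: "t \<in> carrier G"
    and nz: "frag_of (f a, t) \<notin> tensor_sub B G"
  shows "nontrivial_map (tensor A G) (tensor B G) (tensor_map A G B G f (\<lambda>x. x))"
proof -
  interpret A: comm_group A by fact
  interpret B: comm_group B by fact
  interpret G: comm_group G by fact
  interpret F: comm_group "tensor_free B G" by (rule comm_group_tensor_free)
  interpret FA: comm_group "tensor_free A G" by (rule comm_group_tensor_free)
  have N: "subgroup (tensor_sub B G) (tensor_free B G)"
    by (rule subgroup_tensor_sub[OF B.is_group G.is_group])
  have NA: "subgroup (tensor_sub A G) (tensor_free A G)"
    by (rule subgroup_tensor_sub[OF A.is_group G.is_group])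
  have c: "frag_of (a, t) \<in> carrier (tensor_free A G)" "frag_of (f a, t) \<in> carrier (tensor_free B G)"
    using a t hom_in_carrier[OF f a] by (auto simp: tensor_free_def)
  have "frag_of (f a, t) \<in> tensor_map A G B G f (\<lambda>x. x) (pure_tensor A G a t)"
    unfolding tensor_map_def pure_tensor_def
    using FA.rcos_self[OF c(1) NA] F.rcos_self[OF c(2) N] by force
  then have "tensor_map A G B G f (\<lambda>x. x) (pure_tensor A G a t) \<noteq> \<one>\<^bsub>tensor B G\<^esub>"
    using nz by (auto simp: tensor_def)
  then show ?thesis
    unfolding nontrivial_map_def using pure_tensor_closed[OF a t] by blast
qed

theorem theoremA1:
  fixes A :: "('a, 'c) monoid_scheme" and B :: "('b, 'd) monoid_scheme"
    and G :: "('g, 'e) monoid_scheme" and f :: "'a \<Rightarrow> 'b"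
  assumes "comm_group A" and "comm_group B" and "comm_group G"
    and "f \<in> hom A B"
    and "(\<exists>x\<in>carrier G. group.ord G x = 0) \<or> direct_sum_of_cyclic G"
    and "nontrivial_map (tensor A G) (tensor B G) (tensor_map A G B G f (\<lambda>x. x))"
  shows "\<forall>k\<ge>1. nontrivial_map (tensor A (tensor_power k G)) (tensor B (tensor_power k G))
                 (tensor_map A (tensor_power k G) B (tensor_power k G) f (\<lambda>x. x))"
proof (intro allI impI)
  fix k :: nat assume "k \<ge> 1"
  obtain a g where a: "a \<in> carrier A" and g: "g \<in> carrier G" and nz: "frag_of (f a, g) \<notin> tensor_sub B G"
    using nontrivial_tensor_mapD[OF assms(1-3,6)] by blast
  interpret B: comm_group B by fact
  interpret G: comm_group G by fact
  have b: "f a \<in> carrier B" using hom_in_carrier[OF assms(4) a] .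
  have nz': "pure_tensor B G (f a) g \<noteq> \<one>\<^bsub>tensor B G\<^esub>"
    using nz pure_tensor_eq_one_iff[OF B.is_group G.is_group b g] by simp
  have "\<not> powers_vanish k B G (f a)"
  proof
    assume pv: "powers_vanish k B G (f a)"
    from assms(5) show False
    proof
      assume "\<exists>x\<in>carrier G. group.ord G x = 0"
      then obtain N where "N > 0" "f a [^]\<^bsub>B\<^esub> int N = \<one>\<^bsub>B\<^esub>"
        using infinite_order_powers_vanish[OF assms(3,2) b pv] by blast
      then show False
        using torsion_powers_vanish[OF assms(3,2) _ b _ pv g] nz' by blast
    next
      assume "direct_sum_of_cyclic G"
      then show False
        using direct_sum_powers_vanish[OF assms(3,2) _ b pv g] nz' by blast
    qed
  qed
  \<comment> \<open>The contrapositive of \<open>powers_vanishI\<close> yields a class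
    \<open>t\<close>, not necessarily a pure tensor, on which the induced map is nonzero.\<close>
  then obtain t where "t \<in> carrier (tensor_power k G)" "frag_of (f a, t) \<notin> tensor_sub B (tensor_power k G)"
    using powers_vanishI[OF assms(3,2) b] by blast
  then show "nontrivial_map (tensor A (tensor_power k G)) (tensor B (tensor_power k G))
                 (tensor_map A (tensor_power k G) B (tensor_power k G) f (\<lambda>x. x))"
    by (rule nontrivial_tensor_mapI[OF assms(1,2) comm_group_tensor_power[OF assms(3)] assms(4) a])
qed

end
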